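(* For every $j\ge0$, define polynomials $A_{j,r}(x)$ ($r\ge 0$) by $$\sum_{r\ge0}A_{j,r}(x)W^r=(1+4xW)^{2j}\,P_j\!\left(\frac{x(1+2W+4xW^2)}{(1+4xW)^2}\right).$$ Then $$\sum_{r\ge0}A_{j,r}(x)W^r=\sum_{s=0}^{j}D_{2j,s}\,x^s(1+4xW)^{2j-2s}(1+2W+4xW^2)^s,$$ and therefore $A_{j,r}(x)\in\mathbb N[x]$ for all $r\ge0$. Moreover, for all $j,f\ge0$, $$\Phi_{j,f}(x)=\sum_{r=0}^{f}\binom fr A_{j,r}(x).$$
   Context: $\mathbb N=\{0,1,2,\dots\}$. For $n\ge1$, $\mathfrak B_n$ is the hyperoctahedral group of signed permutations: words $\pi=\pi_1\cdots\pi_n$ of nonzero integers such that $|\pi_1|,\dots,|\pi_n|$ is a permutation of $[n]=\{1,\dots,n\}$, with $\pi(i)=\pi_i$, $\pi(-i)=-\pi(i)$. $\mathcal I_n^B$ is the set of $\pi\in\mathfrak B_n$ with $\pi^2=\mathrm{id}$ (for $n=0$, a single empty involution). With $\pi_0=0$ and the usual order on $\mathbb Z$, $\operatorname{des}^B(\pi)=\#\{0\le i\le n-1:\pi_i>\pi_{i+1}\}$. $\operatorname{fix}_B(\pi)=\#\{i\in[n]:|\pi(i)|=i\}$, and $\operatorname{cyc}_2(\pi)$ is the number of two-cycles of the ordinary involution $i\mapsto|\pi(i)|$ of $[n]$, so $2\operatorname{cyc}_2(\pi)+\operatorname{fix}_B(\pi)=n$. For $j,f\ge0$, $$F_{j,f}(t)=\sum_{\substack{\pi\in\mathcal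 I_{2j+f}^B\\ \operatorname{cyc}_2(\pi)=j,\ \operatorname{fix}_B(\pi)=f}}t^{\operatorname{des}^B(\pi)}.$$ This polynomial is palindromic with center $(2j+f)/2$, and $\Phi_{j,f}$ denotes the unique polynomial such that $F_{j,f}(t)=(1+t)^{2j+f}\,\Phi_{j,f}\!\left(\frac{t}{(1+t)^2}\right)$. The fixed-point-free case is $J_{2j}^B(t)=F_{j,0}(t)$, and $P_j(x)=\sum_{s=0}^{j}D_{2j,s}x^s$ denotes its $\gamma$-polynomial, i.e. $J_{2j}^B(t)=(1+t)^{2j}P_j\!\left(\frac{t}{(1+t)^2}\right)$ (so $P_j=\Phi_{j,0}$). The following is a known theorem of Wan, Gao, Li and Yang taken as given: $D_{2j,s}\in\mathbb N$ for all $0\le s\le j$. *)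

theory Defs
  imports "HOL-Computational_Algebra.Computational_Algebra"
begin

section \<open>Signed permutations and type B involutions\<close>

text \<open>A signed permutation is the word \<open>\<pi>\<^sub>1 \<dots> \<pi>\<^sub>n\<close>, stored as a list.\<close>

definition signed_perms :: "nat \<Rightarrow> int list set" where
  "signed_perms n = {w. length w = n \<and> distinct (map abs w) \<and> abs ` set w = {1..int n}}"

text \<open>The odd extension \<open>\<pi>(i) = \<pi>\<^sub>i\<close>, \<open>\<pi>(-i) = -\<pi>(i)\<close>, together with the convention
  \<open>\<pi>\<^sub>0 = 0\<close>. Only meaningful for \<open>\<bar>i\<bar> \<le> length w\<close>.\<close>

definition act :: "int list \<Rightarrow> int \<Rightarrow> int" where
  "act w i = (if i = 0 then 0 else sgn i * w ! (nat \<bar>i\<bar> - 1))"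

definition involutionsB :: "nat \<Rightarrow> int list set" where
  "involutionsB n = {w \<in> signed_perms n. \<forall>i\<in>{- int n..int n}. act w (act w i) = i}"

definition desB :: "int list \<Rightarrow> nat" where
  "desB w = card {i \<in> {0..<int (length w)}. act w i > act w (i + 1)}"

definition fixB :: "int list \<Rightarrow> nat" where
  "fixB w = card {i \<in> {1..int (length w)}. \<bar>act w i\<bar> = i}"

definition cyc2 :: "int list \<Rightarrow> nat" where
  "cyc2 w = card {{i, \<bar>act w i\<bar>} | i. i \<in> {1..int (length w)} \<and> \<bar>act w i\<bar> \<noteq> i}"


section \<open>Descent polynomials and their gamma-polynomials\<close>

definition F :: "nat \<Rightarrow> nat \<Rightarrow> rat poly" where
  "F j f = (\<Sum>w \<in> {w \<in> involutionsB (2 * j + f). cyc2 w = j \<and> fixB w = f}. monom 1 (desB w))"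

text \<open>The identity \<open>h(t) = (1 + t)\<^sup>n p(t / (1 + t)\<^sup>2)\<close> of rational functions, expressed by its
  values at all rational points other than the pole \<open>t = -1\<close>.\<close>

definition is_gamma_poly :: "nat \<Rightarrow> rat poly \<Rightarrow> rat poly \<Rightarrow> bool" where
  "is_gamma_poly n h p \<longleftrightarrow>
    (\<forall>t. t \<noteq> -1 \<longrightarrow> poly h t = (1 + t) ^ n * poly p (t / (1 + t)\<^sup>2))"

definition gamma_poly :: "nat \<Rightarrow> rat poly \<Rightarrow> rat poly" where
  "gamma_poly n h = (THE p. is_gamma_poly n h p)"

definition \<Phi> :: "nat \<Rightarrow> nat \<Rightarrow> rat poly" where
  "\<Phi> j f = gamma_poly (2 * j + f) (F j f)"

text \<open>\<open>J j\<close>, \<open>P j\<close> and \<open>D j s\<close> stand for \<open>J\<^sub>2\<^sub>j\<^sup>B\<close>, \<open>P\<^sub>j\<close> and \<open>D\<^sub>2\<^sub>j\<^sub>,\<^sub>s\<close>.\<close>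

definition J :: "nat \<Rightarrow> rat poly" where
  "J j = F j 0"

definition P :: "nat \<Rightarrow> rat poly" where
  "P j = gamma_poly (2 * j) (J j)"

definition D :: "nat \<Rightarrow> nat \<Rightarrow> rat" where
  "D j s = coeff (P j) s"


section \<open>The polynomials \<open>A\<^sub>j\<^sub>,\<^sub>r\<close>\<close>

text \<open>The generating function is a formal power series in \<open>W = fps_X\<close> with coefficients in
  \<open>\<rat>[x]\<close>. Division of \<open>fps\<close> is only available over coefficient fields, so the inverse of a
  power series with constant term \<open>1\<close> is taken from \<^const>\<open>fps_right_inverse\<close>.\<close>

definition unit_inverse :: "rat poly fps \<Rightarrow> rat poly fps" where
  "unit_inverse g = fps_right_inverse g 1"

lemma unit_inverse_right: "fps_nth g 0 = 1 \<Longrightarrow> g * unit_inverse g = 1"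
  unfolding unit_inverse_def by (rule fps_right_inverse) simp

abbreviation xs :: "rat poly fps" where
  "xs \<equiv> fps_const [:0, 1:]"

abbreviation W :: "rat poly fps" where
  "W \<equiv> fps_X"

text \<open>Evaluation of \<open>p \<in> \<rat>[y]\<close> at an element of \<open>\<rat>[x][[W]]\<close>.\<close>

definition poly_at :: "rat poly \<Rightarrow> rat poly fps \<Rightarrow> rat poly fps" where
  "poly_at p g = poly (map_poly (\<lambda>c. fps_const [:c:]) p) g"

definition A_gf :: "nat \<Rightarrow> rat poly fps" where
  "A_gf j = (1 + 4 * xs * W) ^ (2 * j) *
     poly_at (P j) (xs * (1 + 2 * W + 4 * xs * W\<^sup>2) * unit_inverse ((1 + 4 * xs * W)\<^sup>2))"

definition A :: "nat \<Rightarrow> nat \<Rightarrow> rat poly" where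
  "A j r = fps_nth (A_gf j) r"

end

theory Submission
  imports Defs "HOL-Library.Product_Lexorder"
begin

text \<open>Dividing \<open>F j f\<close> by \<open>(1 - t)\<^bsup>2j+f+1\<^esup>\<close> turns \<open>t\<^sup>k\<close> into a counter of pairs of an involution and a labelling
  \<open>0 = g\<^sub>0 \<le> g\<^sub>1 \<le> \<dots> \<le> g\<^sub>n \<le> k\<close> that increases strictly at the descents. Extending both oddly to \<open>{-n..n}\<close>, such a
  pair is the same as the table \<open>M a b = #{i. g i = a \<and> g (\<pi> i) = b}\<close>, which is symmetric and centrally symmetric.
  The fixed points of \<open>\<pi>\<close> are read off the two diagonals of \<open>M\<close> and can be chosen independently of the rest, in
  \<open>[z\<^sup>f] (1 + z)\<^sup>k / (1 - z)\<^bsup>k+1\<^esup>\<close> ways (a Delannoy number). Hence \<open>F j f\<close> arises from \<open>J j\<close> by the substitution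
  \<open>t \<mapsto> t (1 + z) / (1 - z)\<close> in \<open>J j / (1 - t)\<^bsup>2j+1\<^esup>\<close>. After inserting the gamma expansion of \<open>J j\<close> and rescaling \<open>z\<close>,
  this is the binomial transform of the generating function of the \<open>A j r\<close>.\<close>

section \<open>Gamma polynomials\<close>

text \<open>Equal labels are allowed only where \<open>p\<close> increases, so positions are sorted
  by \<open>(g i, g (p i))\<close>, and \<open>p\<close> matches the cell \<open>(a, b)\<close> with
  \<open>(b, a)\<close> in increasing order. That is why cell sizes alone determine the pair. The
  number of choices of fixed points depends on \<open>k\<close> and \<open>f\<close> only, so the
  counts for \<open>F j f\<close> are multiples of those for \<open>J j\<close>, coefficient by
  coefficient. The rescaling is by \<open>1 - t\<close>: each further fixed point raises the
  exponent of the denominator by one. The constants in \<open>A_gf\<close> come from the last step.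
  Put \<open>y = 1 + t\<close>, \<open>x = t / y^2\<close> and \<open>W = yz / (1 - yz)\<close>. As
  \<open>y^2 - 4t = (1 - t)^2\<close>, one gets
  \<open>y (1 - yz) (1 + 4xW) = y - (1 - t)^2 z\<close> and
  \<open>(1 - yz)^2 (1 + 2W + 4xW^2) = 1 - (1 - t)^2 z^2\<close>. With denominators cleared, the
  Delannoy substitution turns the factor \<open>1 + t\<close> of the gamma basis into the first
  right-hand side, and the factor \<open>t\<close> into \<open>t\<close> times the second.\<close>

lemma is_gamma_poly_unique:
  assumes "is_gamma_poly n h p" "is_gamma_poly n h q"
  shows "p = q"
proof (rule ccontr)
  assume "p \<noteq> q"
  \<comment> \<open>\<open>t\<close> and \<open>1 / t\<close> give the same value of
    \<open>t / (1 + t)^2\<close>; the sample points stay at \<open>t >= 1\<close>, where the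
    function is injective.\<close>
  let ?x = "\<lambda>m::nat. of_nat (Suc m) / (1 + of_nat (Suc m))\<^sup>2 :: rat"
  have "inj ?x"
  proof (rule injI)
    fix a b assume "?x a = ?x b"
    then have "of_nat (Suc a) * (1 + of_nat (Suc b))\<^sup>2 = (of_nat (Suc b) * (1 + of_nat (Suc a))\<^sup>2 :: rat)"
      by (simp add: field_simps)
    \<comment> \<open>With \<open>A = a + 1\<close> and \<open>B = b + 1\<close> the two sides
      differ by \<open>(A - B) (1 - A B)\<close>, and \<open>A B - 1 = a b + a + b\<close>.\<close>
    then have "(of_nat a - of_nat b) * (of_nat a * of_nat b + of_nat a + of_nat b :: rat) = 0"
      by (simp add: power2_eq_square algebra_simps)
    then have "of_nat a = (of_nat b :: rat) \<or> of_nat (a * b + a + b) = (0 :: rat)"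
      by simp
    then show "a = b" unfolding of_nat_eq_iff of_nat_eq_0_iff by auto
  qed
  moreover have "range ?x \<subseteq> {x. poly (p - q) x = 0}"
  proof safe
    fix m
    have *: "1 + of_nat (Suc m) \<noteq> (0 :: rat)"
      by (metis of_nat_Suc of_nat_neq_0)
    moreover from this have "of_nat (Suc m) \<noteq> (-1 :: rat)" by (metis add.right_inverse)
    ultimately show "poly (p - q) (?x m) = 0"
      using assms[unfolded is_gamma_poly_def, rule_format, of "of_nat (Suc m)"] by (simp del: of_nat_Suc)
  qed
  ultimately have "infinite {x. poly (p - q) x = 0}"
    by (meson finite_subset range_inj_infinite)
  then show False using \<open>p \<noteq> q\<close> poly_roots_finite[of "p - q"] by simp
qed

lemma gamma_poly_eqI: "is_gamma_poly n h p \<Longrightarrow> gamma_poly n h = p"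
  unfolding gamma_poly_def using is_gamma_poly_unique by blast

text \<open>Subtracting \<open>coeff h 0\<close> times \<open>(1 + t)^(2j)\<close> kills the
  constant term and, by symmetry, the top one. What remains is \<open>t\<close> times a palindromic
  polynomial with center \<open>j - 1\<close>.\<close>

lemma palindromic_gamma_expansion:
  fixes h :: "rat poly"
  assumes "degree h \<le> 2 * j" "\<And>i. i \<le> 2 * j \<Longrightarrow> coeff h i = coeff h (2 * j - i)"
  shows "\<exists>c. h = (\<Sum>s=0..j. smult (c s) ([:0, 1:] ^ s * [:1, 1:] ^ (2 * j - 2 * s)))"
  using assms
proof (induction j arbitrary: h)
  case 0
  then have "degree h = 0" by simp
  then have "h = smult (coeff h 0) 1" by (metis degree_eq_zeroE coeff_pCons_0 mult.right_neutral one_pCons smult_0_right smult_pCons)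
  then show ?case by (intro exI[of _ "coeff h"]) simp
next
  case (Suc j)
  have c11: "coeff ([:1, 1:] ^ m) i = (of_nat (m choose i) :: rat)" for m i
    using coeff_linear_poly_power[of i m 1 "1::rat"]
    by (cases "i \<le> m") (simp_all add: coeff_eq_0 degree_linear_power binomial_eq_0)
  define g where "g = h - smult (coeff h 0) ([:1, 1:] ^ (2 * Suc j))"
  have g0: "coeff g 0 = 0" unfolding g_def by (simp add: c11 del: power_Suc mult_Suc_right)
  then obtain g1 where g1: "g = [:0, 1:] * g1"
    by (metis mult.commute dvdE poly_eq_0_iff_dvd poly_0_coeff_0 minus_zero)
  have cg: "coeff g (Suc i) = coeff g1 i" for i unfolding g1 by simp
  have pal: "coeff g i = coeff g (2 * Suc j - i)" if "i \<le> 2 * Suc j" for i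
    unfolding g_def coeff_diff coeff_smult c11 using Suc.prems(2)[OF that] binomial_symmetric[OF that] by simp
  have hi: "coeff g i = 0" if "i > 2 * Suc j" for i
    unfolding g_def coeff_diff coeff_smult c11 using Suc.prems(1) that by (simp add: coeff_eq_0)
  have "coeff g1 i = 0" if "i > 2 * j" for i
  proof (cases "i = Suc (2 * j)")
    case True
    then show ?thesis using pal[of "2 * Suc j"] cg[of i] g0 by simp
  next
    case False
    then show ?thesis using that hi[of "Suc i"] cg[of i] by simp
  qed
  then have "degree g1 \<le> 2 * j" by (simp add: degree_le)
  moreover have "coeff g1 i = coeff g1 (2 * j - i)" if "i \<le> 2 * j" for i
    using pal[of "Suc i"] that unfolding cg[symmetric] by (simp add: Suc_diff_le)
  ultimately obtain c where c: "g1 = (\<Sum>s=0..j. smult (c s) ([:0, 1:] ^ s * [:1, 1:] ^ (2 * j - 2 * s)))"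
    using Suc.IH by blast
  have "h = smult (coeff h 0) ([:1, 1:] ^ (2 * Suc j)) + [:0, 1:] * g1"
    using g1 unfolding g_def by simp
  also have "\<dots> = (\<Sum>s=0..Suc j. smult (case s of 0 \<Rightarrow> coeff h 0 | Suc s \<Rightarrow> c s) ([:0, 1:] ^ s * [:1, 1:] ^ (2 * Suc j - 2 * s)))"
    unfolding sum.atLeast0_atMost_Suc_shift c sum_distrib_left
    by (simp add: mult_smult_right mult.assoc del: mult_pCons_left mult_pCons_right)
  finally show ?case by blast
qed

lemma gamma_expansion_poly:
  fixes c :: "nat \<Rightarrow> rat"
  assumes h: "h = (\<Sum>s=0..j. smult (c s) ([:0, 1:] ^ s * [:1, 1:] ^ (2 * j - 2 * s)))"
  shows "gamma_poly (2 * j) h = (\<Sum>s=0..j. monom (c s) s)"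
proof (rule gamma_poly_eqI, unfold is_gamma_poly_def, intro allI impI)
  fix t :: rat assume "t \<noteq> -1"
  then have nz: "1 + t \<noteq> 0" by (metis add_eq_0_iff)
  have "t ^ s * (1 + t) ^ (2 * j - 2 * s) = (1 + t) ^ (2 * j) * (t / (1 + t)\<^sup>2) ^ s" if "s \<le> j" for s
  proof -
    have "(1 + t) ^ (2 * j) = (1 + t) ^ (2 * j - 2 * s) * ((1 + t)\<^sup>2) ^ s"
      using that by (simp flip: power_mult power_add)
    then show ?thesis using nz by (simp add: power_divide)
  qed
  then show "poly h t = (1 + t) ^ (2 * j) * poly (\<Sum>s=0..j. monom (c s) s) (t / (1 + t)\<^sup>2)"
    unfolding h poly_sum poly_monom sum_distrib_left
    by (intro sum.cong refl) (simp add: add.commute)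
qed

section \<open>Weighted binomial and Delannoy transforms\<close>

definition binomial_transform :: "'a::comm_ring_1 \<Rightarrow> 'a fps \<Rightarrow> 'a fps" where
  "binomial_transform y a = Abs_fps (\<lambda>f. y ^ f * (\<Sum>r=0..f. of_nat (f choose r) * fps_nth a r))"

lemma binomial_transform_add: "binomial_transform y (a + b) = binomial_transform y a + binomial_transform y b"
  by (rule fps_ext) (simp add: binomial_transform_def sum.distrib algebra_simps)

lemma binomial_transform_const_mult: "binomial_transform y (fps_const c * a) = fps_const c * binomial_transform y a"
  by (rule fps_ext) (simp add: binomial_transform_def sum_distrib_left mult_ac)

lemma binomial_transform_sum: "binomial_transform y (\<Sum>i\<in>S. a i) = (\<Sum>i\<in>S. binomial_transform y (a i))"
proof (induction S rule: infinite_finite_induct)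
  case (insert x S)
  then show ?case by (simp add: binomial_transform_add)
qed (auto intro!: fps_ext simp: binomial_transform_def)

lemma binomial_transform_1: "(1 - fps_const y * fps_X) * binomial_transform y 1 = 1"
proof (rule fps_ext)
  have "(\<Sum>r=0..f. of_nat (f choose r) * fps_nth 1 r) = (1::'a)" for f :: nat
    by (subst sum.remove[of _ 0]) auto
  then have *: "fps_nth (binomial_transform y 1) f = y ^ f" for f
    unfolding binomial_transform_def by simp
  show "fps_nth ((1 - fps_const y * fps_X) * binomial_transform y 1) n = fps_nth 1 n" for n
    by (cases n) (simp_all add: left_diff_distrib mult.assoc *)
qed

text \<open>Pascal's rule. It expresses multiplication by \<open>W = yz / (1 - yz)\<close> with the
  denominator cleared.\<close>

lemma binomial_transform_X_mult:
  "(1 - fps_const y * fps_X) * binomial_transform y (fps_X * a) = fps_const y * fps_X * binomial_transform y a"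
proof (rule fps_ext)
  fix n
  show "fps_nth ((1 - fps_const y * fps_X) * binomial_transform y (fps_X * a)) n
     = fps_nth (fps_const y * fps_X * binomial_transform y a) n"
  proof (cases n)
    case 0 then show ?thesis by (simp add: binomial_transform_def)
  next
    case (Suc f)
    let ?b = "\<lambda>r. fps_nth (fps_X * a) r"
    have "(\<Sum>r=0..Suc f. of_nat (Suc f choose r) * ?b r) = (\<Sum>r=0..f. of_nat (Suc f choose Suc r) * fps_nth a r)"
      by (subst sum.atLeast0_atMost_Suc_shift) simp
    also have "\<dots> = (\<Sum>r=0..f. of_nat (f choose r) * fps_nth a r) + (\<Sum>r=0..f. of_nat (f choose Suc r) * fps_nth a r)"
      by (simp add: sum.distrib algebra_simps)
    also have "(\<Sum>r=0..f. of_nat (f choose Suc r) * fps_nth a r) = (\<Sum>r=0..Suc f. of_nat (f choose r) * ?b r)"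
      by (subst sum.atLeast0_atMost_Suc_shift) simp
    also have "\<dots> = (\<Sum>r=0..f. of_nat (f choose r) * ?b r)" by (simp add: binomial_eq_0)
    finally show ?thesis unfolding Suc
      by (simp add: binomial_transform_def left_diff_distrib mult.assoc algebra_simps del: sum.cl_ivl_Suc)
  qed
qed

text \<open>The transform substitutes \<open>W = yz / (1 - yz)\<close>, up to the factor \<open>1 / (1 - yz)\<close>; the powers of
  \<open>1 - yz\<close> below clear the denominators.\<close>

lemma binomial_transform_powers:
  fixes y x :: "'a::comm_ring_1"
  defines "p \<equiv> 1 + fps_const (4 * x) * fps_X" and "q \<equiv> 1 + 2 * fps_X + fps_const (4 * x) * fps_X\<^sup>2"
    and "Y \<equiv> fps_const y * fps_X"
  shows "(1 - Y) ^ (m + 2 * s + 1) * binomial_transform y (p ^ m * q ^ s)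
     = (1 - Y + fps_const (4 * x) * Y) ^ m * ((1 - Y)\<^sup>2 + 2 * Y * (1 - Y) + fps_const (4 * x) * Y\<^sup>2) ^ s"
proof -
  let ?B = "binomial_transform y"
  have X: "(1 - Y) * ?B (fps_X * a) = Y * ?B a" for a
    unfolding Y_def by (rule binomial_transform_X_mult)
  have p: "(1 - Y) * ?B (p * a) = (1 - Y + fps_const (4 * x) * Y) * ?B a" for a
  proof -
    have "?B (p * a) = ?B a + fps_const (4 * x) * ?B (fps_X * a)"
      unfolding p_def distrib_right binomial_transform_add mult.assoc binomial_transform_const_mult by simp
    then have "(1 - Y) * ?B (p * a) = (1 - Y) * ?B a + fps_const (4 * x) * ((1 - Y) * ?B (fps_X * a))"
      by (simp only: distrib_left mult.left_commute)
    then show ?thesis unfolding X by (simp only: distrib_right mult.assoc)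
  qed
  have q: "(1 - Y)\<^sup>2 * ?B (q * a) = ((1 - Y)\<^sup>2 + 2 * Y * (1 - Y) + fps_const (4 * x) * Y\<^sup>2) * ?B a" for a
  proof -
    have "q * a = a + fps_const 2 * (fps_X * a) + fps_const (4 * x) * (fps_X * (fps_X * a))"
      unfolding q_def by (simp add: distrib_right mult.assoc power2_eq_square numeral_fps_const)
    then have "?B (q * a) = ?B a + fps_const 2 * ?B (fps_X * a) + fps_const (4 * x) * ?B (fps_X * (fps_X * a))"
      by (simp only: binomial_transform_add binomial_transform_const_mult)
    then have "(1 - Y)\<^sup>2 * ?B (q * a) = (1 - Y)\<^sup>2 * ?B a + fps_const 2 * (1 - Y) * ((1 - Y) * ?B (fps_X * a))
       + fps_const (4 * x) * ((1 - Y) * ((1 - Y) * ?B (fps_X * (fps_X * a))))"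
      by (simp only: distrib_left power2_eq_square mult_ac)
    also have "(1 - Y) * ((1 - Y) * ?B (fps_X * (fps_X * a))) = Y * (Y * ?B a)"
      unfolding X mult.left_commute[of "1 - Y" Y] by simp
    finally show ?thesis unfolding X
      by (simp only: distrib_left distrib_right power2_eq_square mult_ac numeral_fps_const)
  qed
  \<comment> \<open>Each \<open>q\<close>, of degree 2 in \<open>W\<close>, costs two factors
    \<open>1 - Y\<close>, each \<open>p\<close> costs one, and the constant series costs the last
    one.\<close>
  have "(1 - Y) ^ (2 * s + 1) * ?B (q ^ s) = ((1 - Y)\<^sup>2 + 2 * Y * (1 - Y) + fps_const (4 * x) * Y\<^sup>2) ^ s"
  proof (induction s)
    case 0 then show ?case using binomial_transform_1[of y] by (simp add: Y_def)
  next
    case (Suc s)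
    have "(1 - Y) ^ (2 * Suc s + 1) * ?B (q ^ Suc s) = (1 - Y) ^ (2 * s + 1) * ((1 - Y)\<^sup>2 * ?B (q * q ^ s))"
      by (simp add: power2_eq_square mult_ac)
    then show ?case unfolding q mult.left_commute[of "(1 - Y) ^ (2 * s + 1)"] Suc.IH by simp
  qed
  then show ?thesis
  proof (induction m)
    case (Suc m)
    have "(1 - Y) ^ (Suc m + 2 * s + 1) * ?B (p ^ Suc m * q ^ s) = (1 - Y) ^ (m + 2 * s + 1) * ((1 - Y) * ?B (p * (p ^ m * q ^ s)))"
      by (simp add: mult_ac)
    then show ?case unfolding p mult.left_commute[of "(1 - Y) ^ (m + 2 * s + 1)"] Suc.IH[OF Suc.prems] by simp
  qed simp
qed

section \<open>Delannoy numbers and their transform\<close>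

fun delannoy :: "nat \<Rightarrow> nat \<Rightarrow> nat" where
  "delannoy k 0 = 1"
| "delannoy 0 (Suc f) = 1"
| "delannoy (Suc k) (Suc f) = delannoy (Suc k) f + delannoy k (Suc f) + delannoy k f"

text \<open>Since \<open>\<Sum>\<^sub>f delannoy k f z\<^sup>f = (1 + z)\<^sup>k / (1 - z)\<^bsup>k+1\<^esup>\<close>, this is the substitution
  \<open>t \<mapsto> t (1 + qz) / (1 - qz)\<close> in \<open>c(t)\<close>, up to the factor \<open>1 / (1 - qz)\<close>. The inner series are in \<open>t\<close>, the
  outer variable is \<open>z\<close>.\<close>

definition delannoy_transform :: "'a::comm_ring_1 fps \<Rightarrow> 'a fps \<Rightarrow> 'a fps fps" where
  "delannoy_transform q c = Abs_fps (\<lambda>f. q ^ f * Abs_fps (\<lambda>k. of_nat (delannoy k f) * fps_nth c k))"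

lemma delannoy_transform_add: "delannoy_transform q (a + b) = delannoy_transform q a + delannoy_transform q b"
proof -
  have "Abs_fps (\<lambda>k. of_nat (delannoy k f) * fps_nth (a + b) k) = Abs_fps (\<lambda>k. of_nat (delannoy k f) * fps_nth a k) 
    + Abs_fps (\<lambda>k. of_nat (delannoy k f) * fps_nth b k)" for f
    by (rule fps_ext) (simp add: algebra_simps)
  then show ?thesis unfolding delannoy_transform_def by (intro fps_ext[where 'a = "'a fps"]) (simp add: algebra_simps)
qed

lemma delannoy_transform_const_mult:
  "delannoy_transform q (fps_const e * c) = fps_const (fps_const e) * delannoy_transform q c"
proof -
  have "Abs_fps (\<lambda>k. of_nat (delannoy k f) * fps_nth (fps_const e * c) k) = fps_const e * Abs_fps (\<lambda>k. of_nat (delannoy k f) * fps_nth c k)" for f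
    by (rule fps_ext) (simp add: algebra_simps)
  then show ?thesis unfolding delannoy_transform_def by (intro fps_ext[where 'a = "'a fps"]) (simp add: mult_ac)
qed

lemma delannoy_transform_sum: "delannoy_transform q (\<Sum>i\<in>S. a i) = (\<Sum>i\<in>S. delannoy_transform q (a i))"
proof -
  have z: "delannoy_transform q 0 = 0" using delannoy_transform_const_mult[of q 0 0] by simp
  show ?thesis by (induction S rule: infinite_finite_induct) (simp_all add: delannoy_transform_add z)
qed

lemma delannoy_transform_1:
  "(1 - fps_const q * fps_X) * delannoy_transform q 1 = 1"
proof -
  have "Abs_fps (\<lambda>k. of_nat (delannoy k f) * fps_nth 1 k) = (1 :: 'a fps)" for f
  proof (rule fps_ext)
    have "delannoy 0 f = 1" by (cases f) auto
    then show "fps_nth (Abs_fps (\<lambda>k. of_nat (delannoy k f) * fps_nth 1 k)) n = fps_nth (1 :: 'a fps) n" for n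
      by (cases n) auto
  qed
  then have *: "fps_nth (delannoy_transform q (1::'a fps)) f = q ^ f" for f
    unfolding delannoy_transform_def by simp
  show ?thesis
  proof (rule fps_ext[where 'a = "'a fps"])
    show "fps_nth ((1 - fps_const q * fps_X) * delannoy_transform q 1) n = fps_nth 1 n" for n
      by (cases n) (simp_all add: left_diff_distrib mult.assoc *)
  qed
qed

text \<open>By the recurrence, \<open>1 - z\<close> times the series of
  \<open>delannoy (k + 1) f\<close> in \<open>f\<close> is \<open>1 + z\<close> times that of
  \<open>delannoy k f\<close>. Multiplication by \<open>t\<close> shifts \<open>k\<close>, so
  \<open>t\<close> turns into \<open>t (1 + qz) / (1 - qz)\<close>.\<close>

lemma delannoy_transform_X_mult:
  "(1 - fps_const q * fps_X) * delannoy_transform q (fps_X * c) 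
     = fps_const fps_X * (1 + fps_const q * fps_X) * delannoy_transform q c"
proof (rule fps_ext[where 'a = "'a fps"])
  fix n
  define h where "h b f = Abs_fps (\<lambda>k. of_nat (delannoy k f) * fps_nth b k)" for b :: "'a fps" and f
  have nth: "fps_nth (delannoy_transform q b) f = q ^ f * h b f" for b f
    unfolding delannoy_transform_def h_def by simp
  have h0: "h (fps_X * c) 0 = fps_X * h c 0"
    unfolding h_def by (rule fps_ext) (auto simp: fps_X_mult_nth)
  have hS: "h (fps_X * c) (Suc f) = h (fps_X * c) f + fps_X * h c (Suc f) + fps_X * h c f" for f
  proof (rule fps_ext)
    show "fps_nth (h (fps_X * c) (Suc f)) m = fps_nth (h (fps_X * c) f + fps_X * h c (Suc f) + fps_X * h c f) m" for m
      unfolding h_def by (cases m) (auto simp: algebra_simps)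
  qed
  show "fps_nth ((1 - fps_const q * fps_X) * delannoy_transform q (fps_X * c)) n
     = fps_nth (fps_const fps_X * (1 + fps_const q * fps_X) * delannoy_transform q c) n"
  proof (cases n)
    case 0 then show ?thesis by (simp add: nth h0)
  next
    case (Suc f)
    show ?thesis unfolding Suc mult.assoc fps_mult_left_const_nth distrib_right left_diff_distrib
      by (simp add: nth hS algebra_simps)
  qed
qed

lemma delannoy_transform_powers:
  fixes q :: "'a::comm_ring_1 fps"
  defines "Q \<equiv> fps_const q * fps_X" and "T \<equiv> fps_const fps_X"
  shows "(1 - Q) ^ m * delannoy_transform q ((1 - fps_X) ^ m * c) = (1 - Q - T * (1 + Q)) ^ m * delannoy_transform q c"
   and "(1 - Q) ^ m * delannoy_transform q ((1 + fps_X) ^ m * c) = (1 - Q + T * (1 + Q)) ^ m * delannoy_transform q c"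
   and "(1 - Q) ^ m * delannoy_transform q (fps_X ^ m * c) = (T * (1 + Q)) ^ m * delannoy_transform q c"
proof -
  let ?H = "delannoy_transform q"
  have X: "(1 - Q) * ?H (fps_X * c) = T * (1 + Q) * ?H c" for c
    unfolding Q_def T_def by (rule delannoy_transform_X_mult)
  have iter: "(1 - Q) ^ m * ?H (a ^ m * c) = A ^ m * ?H c"
    if a: "\<And>c. (1 - Q) * ?H (a * c) = A * ?H c" for a A
  proof (induction m)
    case (Suc m)
    have "(1 - Q) ^ Suc m * ?H (a ^ Suc m * c) = (1 - Q) ^ m * ((1 - Q) * ?H (a * (a ^ m * c)))"
      by (simp add: mult_ac)
    then show ?case unfolding a mult.left_commute[of "(1 - Q) ^ m"] Suc.IH by (simp add: mult_ac)
  qed simp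
  have P: "(1 - Q) * ?H ((1 + fps_X) * c) = (1 - Q + T * (1 + Q)) * ?H c" for c
    unfolding distrib_right[of 1 fps_X] delannoy_transform_add distrib_left[of "1 - Q" "?H _"] X by (simp add: algebra_simps)
  have D: "?H ((1 - fps_X) * c) = ?H c - ?H (fps_X * c)" for c
  proof -
    have "(1 - fps_X) * c + fps_X * c = c" by (simp add: algebra_simps)
    then show ?thesis using delannoy_transform_add[of q "(1 - fps_X) * c" "fps_X * c"] by simp
  qed
  have N: "(1 - Q) * ?H ((1 - fps_X) * c) = (1 - Q - T * (1 + Q)) * ?H c" for c
    unfolding D right_diff_distrib[of "1 - Q" "?H _"] X by (simp only: left_diff_distrib)
  show "(1 - Q) ^ m * ?H ((1 - fps_X) ^ m * c) = (1 - Q - T * (1 + Q)) ^ m * ?H c"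
    by (rule iter[OF N])
  show "(1 - Q) ^ m * ?H ((1 + fps_X) ^ m * c) = (1 - Q + T * (1 + Q)) ^ m * ?H c"
    by (rule iter[OF P])
  show "(1 - Q) ^ m * ?H (fps_X ^ m * c) = (T * (1 + Q)) ^ m * ?H c"
    by (rule iter[OF X])
qed

section \<open>Generating function identities\<close>

definition fps_map :: "('a \<Rightarrow> 'b) \<Rightarrow> 'a fps \<Rightarrow> 'b fps" where
  "fps_map h g = Abs_fps (\<lambda>n. h (fps_nth g n))"

text \<open>Serves two coefficient homomorphisms: the embedding \<open>fps_of_poly\<close> and
  evaluation of polynomials at a rational point.\<close>

lemma fps_map_hom:
  fixes h :: "'a::comm_ring_1 \<Rightarrow> 'b::comm_ring_1"
  assumes add: "\<And>a b. h (a + b) = h a + h b" and mult: "\<And>a b. h (a * b) = h a * h b" and 1: "h 1 = 1"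
  shows "fps_map h (a + b) = fps_map h a + fps_map h b" "fps_map h (a - b) = fps_map h a - fps_map h b" "fps_map h (a * b) = fps_map h a * fps_map h b" 
    "fps_map h (a ^ m) = fps_map h a ^ m" "fps_map h (\<Sum>i\<in>S. f i) = (\<Sum>i\<in>S. fps_map h (f i))"
    "fps_map h (fps_const e) = fps_const (h e)" "fps_map h fps_X = fps_X" "fps_map h 1 = 1" "fps_map h (numeral w) = numeral w"
proof -
  have h0: "h 0 = 0" using add[of 0 0] by simp
  have diff: "h (a - b) = h a - h b" for a b using add[of "a - b" b] by simp
  have sum: "h (\<Sum>i\<in>S. f i) = (\<Sum>i\<in>S. h (f i))" for f :: "nat \<Rightarrow> 'a" and S
    by (induction S rule: infinite_finite_induct) (simp_all add: h0 add)
  show a: "fps_map h (a + b) = fps_map h a + fps_map h b" for a b unfolding fps_map_def by (rule fps_ext) (simp add: add)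
  show "fps_map h (a - b) = fps_map h a - fps_map h b" for a b unfolding fps_map_def by (rule fps_ext) (simp add: diff)
  show m: "fps_map h (a * b) = fps_map h a * fps_map h b" for a b 
    unfolding fps_map_def by (rule fps_ext) (simp add: fps_mult_nth sum mult)
  show c: "fps_map h (fps_const e) = fps_const (h e)" for e unfolding fps_map_def by (rule fps_ext) (simp add: h0)
  show "fps_map h fps_X = fps_X" unfolding fps_map_def by (rule fps_ext) (simp add: h0 1)
  show o: "fps_map h 1 = 1" using c[of 1] by (simp add: 1)
  show "fps_map h (a ^ m) = fps_map h a ^ m" by (induction m) (simp_all add: m o)
  show "fps_map h (\<Sum>i\<in>S. f i) = (\<Sum>i\<in>S. fps_map h (f i))"
  proof (induction S rule: infinite_finite_induct)
    case (insert x F) then show ?case by (simp add: a)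
  qed (use c[of 0] h0 in simp_all)
  have n: "fps_map h (of_nat i) = of_nat i" for i
    by (induction i) (use c[of 0] h0 in \<open>simp_all add: a o\<close>)
  then show "fps_map h (numeral w) = numeral w" using n[of "numeral w"] by simp
qed

text \<open>The counts \<open>c\<close> form an infinite series in \<open>t\<close>, so the
  computation runs in power series over power series and is pulled back to polynomial coefficients
  along the injective \<open>\<eta>\<close>.\<close>

lemma Abs_fps_delannoy_gf:
  fixes G :: "nat \<Rightarrow> rat poly" and c :: "nat \<Rightarrow> rat" and e :: "nat \<Rightarrow> rat"
  assumes G: "\<And>f. fps_of_poly (G f) = (1 - fps_X) ^ (2 * j + f + 1) * Abs_fps (\<lambda>k. of_nat (delannoy k f) * c k)"
    and G0: "G 0 = (\<Sum>s=0..j. smult (e s) ([:0, 1:] ^ s * [:1, 1:] ^ (2 * j - 2 * s)))"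
  shows "(1 - fps_const [:1, 1:] * fps_X) ^ (2 * j + 1) * Abs_fps G
    = (\<Sum>s=0..j. fps_const [:e s:] * (fps_const [:0, 1:] * (1 - fps_const ([:1, -1:]\<^sup>2) * fps_X\<^sup>2)) ^ s 
         * (fps_const [:1, 1:] - fps_const ([:1, -1:]\<^sup>2) * fps_X) ^ (2 * j - 2 * s))"
    (is "?L = ?R")
proof -
  define \<eta> where "\<eta> = fps_map (fps_of_poly :: rat poly \<Rightarrow> rat fps)"
  note hom = fps_map_hom[of "fps_of_poly :: rat poly \<Rightarrow> rat fps", folded \<eta>_def, OF fps_of_poly_add fps_of_poly_mult fps_of_poly_1]
  \<comment> \<open>The weight of \<open>z\<close> is \<open>1 - t\<close> because the prefactor of
    \<open>G f\<close> contains \<open>(1 - t)^f\<close>.\<close>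
  define q where "q = (1 - fps_X :: rat fps)"
  define Q where "Q = fps_const q * fps_X"
  define T where "T = fps_const (fps_X :: rat fps)"
  let ?H = "delannoy_transform q"
  let ?c = "Abs_fps c"
  have poly: "fps_of_poly [:1, 1::rat:] = 1 + fps_X" "fps_of_poly [:1, -1::rat:] = q" "fps_of_poly [:0, 1::rat:] = fps_X"
    unfolding q_def by (auto simp: fps_of_poly_pCons)
  have K: "\<eta> (Abs_fps G) = fps_const q ^ (2 * j + 1) * ?H ?c"
    unfolding \<eta>_def fps_map_def by (rule fps_ext[where 'a = "rat fps"]) (simp add: G delannoy_transform_def q_def power_add mult_ac)
  have "delannoy k 0 = 1" for k by (cases k) auto
  then have "(1 - fps_X) ^ (2 * j + 1) * ?c = fps_of_poly (G 0)"
    using G[of 0] by simp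
  also have "\<dots> = (\<Sum>s=0..j. fps_const (e s) * (fps_X ^ s * ((1 + fps_X) ^ (2 * j - 2 * s) * 1)))"
    unfolding G0 fps_of_poly_sum fps_of_poly_smult fps_of_poly_mult fps_of_poly_power poly by simp
  finally have c: "(1 - fps_X) ^ (2 * j + 1) * ?c = (\<Sum>s=0..j. fps_const (e s) * (fps_X ^ s * ((1 + fps_X) ^ (2 * j - 2 * s) * 1)))" .
  have "(1 - Q) ^ (2 * j + 1) * ?H ((1 - fps_X) ^ (2 * j + 1) * ?c)
    = (\<Sum>s=0..j. fps_const (fps_const (e s)) * ((1 - Q) ^ (2 * j + 1) * ?H (fps_X ^ s * ((1 + fps_X) ^ (2 * j - 2 * s) * 1))))"
    unfolding c delannoy_transform_sum delannoy_transform_const_mult sum_distrib_left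
    by (simp only: mult.left_commute)
  also have "\<dots> = (\<Sum>s=0..j. fps_const (fps_const (e s)) * ((T * (1 + Q)) ^ s * (1 - Q) ^ s * (1 - Q + T * (1 + Q)) ^ (2 * j - 2 * s)))"
  proof (rule sum.cong[OF refl])
    fix s assume s: "s \<in> {0..j}"
    \<comment> \<open>The factors \<open>1 - Q\<close> are spent as follows: \<open>s\<close> on
      \<open>t^s\<close>, \<open>2j - 2s\<close> on the power of \<open>1 + t\<close>, one on the
      constant series. The \<open>s\<close> left over combine with \<open>(1 + Q)^s\<close> into a
      power of \<open>1 - Q^2\<close>.\<close>
    have "2 * j + 1 = s + (s + ((2 * j - 2 * s) + 1))" using s by auto
    then have "(1 - Q) ^ (2 * j + 1) = (1 - Q) ^ s * ((1 - Q) ^ s * ((1 - Q) ^ (2 * j - 2 * s) * (1 - Q)))"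
      by (metis power_add power_one_right)
    then have "(1 - Q) ^ (2 * j + 1) * ?H (fps_X ^ s * ((1 + fps_X) ^ (2 * j - 2 * s) * 1))
      = (1 - Q) ^ s * (((1 - Q) ^ (2 * j - 2 * s) * (1 - Q)) * ((1 - Q) ^ s * ?H (fps_X ^ s * ((1 + fps_X) ^ (2 * j - 2 * s) * 1))))"
      by (simp only: mult_ac)
    also have "\<dots> = (1 - Q) ^ s * ((T * (1 + Q)) ^ s * ((1 - Q) * ((1 - Q) ^ (2 * j - 2 * s) * ?H ((1 + fps_X) ^ (2 * j - 2 * s) * 1))))"
      unfolding delannoy_transform_powers(3)[of q, folded Q_def T_def] by (simp only: mult_ac)
    also have "\<dots> = (1 - Q) ^ s * ((T * (1 + Q)) ^ s * ((1 - Q + T * (1 + Q)) ^ (2 * j - 2 * s) * ((1 - Q) * ?H 1)))"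
      unfolding delannoy_transform_powers(2)[of q, folded Q_def T_def] by (simp only: mult_ac)
    also have "(1 - Q) * ?H 1 = 1" unfolding Q_def by (rule delannoy_transform_1)
    finally show "fps_const (fps_const (e s)) * ((1 - Q) ^ (2 * j + 1) * ?H (fps_X ^ s * ((1 + fps_X) ^ (2 * j - 2 * s) * 1)))
      = fps_const (fps_const (e s)) * ((T * (1 + Q)) ^ s * (1 - Q) ^ s * (1 - Q + T * (1 + Q)) ^ (2 * j - 2 * s))"
      by (simp only: mult_ac mult_1_left mult_1_right)
  qed
  also have "\<dots> = (\<Sum>s=0..j. fps_const (fps_const (e s)) * (fps_const fps_X * (1 - fps_const (q\<^sup>2) * fps_X\<^sup>2)) ^ s 
         * (fps_const (1 + fps_X) - fps_const (q\<^sup>2) * fps_X) ^ (2 * j - 2 * s))"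
  proof -
    have "(T * (1 + Q)) * (1 - Q) = fps_const fps_X * (1 - fps_const (q\<^sup>2) * fps_X\<^sup>2)"
      unfolding Q_def T_def by (simp add: power2_eq_square algebra_simps flip: fps_const_mult)
    moreover have "1 - Q + T * (1 + Q) = (1 + T) - (1 - T) * Q" by (simp add: algebra_simps)
    moreover have "(1 - T) * Q = fps_const (q\<^sup>2) * fps_X" "1 + T = fps_const (1 + fps_X)"
      unfolding Q_def T_def q_def power2_eq_square
      by (simp_all only: fps_const_mult[symmetric] fps_const_sub[symmetric] fps_const_add[symmetric] fps_const_1_eq_1 mult.assoc)
    ultimately show ?thesis by (simp only: mult.assoc power_mult_distrib[symmetric])
  qed
  finally have R: "(1 - Q) ^ (2 * j + 1) * ?H ((1 - fps_X) ^ (2 * j + 1) * ?c) = \<eta> ?R"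
    unfolding hom poly fps_of_poly_power fps_of_poly_const .
  have "\<eta> ?L = ((1 - fps_const (1 + fps_X) * fps_X) * fps_const q) ^ (2 * j + 1) * ?H ?c"
    unfolding hom poly K by (simp only: power_mult_distrib mult.assoc)
  \<comment> \<open>Since \<open>Q = (1 - t) z\<close>, the right-hand side is
    \<open>(1 - t) - (1 + t) Q\<close>; its factor \<open>1 - t\<close> matches the power of
    \<open>1 - t\<close> in the prefactor of \<open>G\<close>.\<close>
  also have "(1 - fps_const (1 + fps_X) * fps_X) * fps_const q = 1 - Q - T * (1 + Q)"
    unfolding Q_def T_def q_def by (simp add: algebra_simps flip: fps_const_sub fps_const_add)
  finally have "\<eta> ?L = \<eta> ?R"
    unfolding R[symmetric] delannoy_transform_powers(1)[of q, folded Q_def T_def] .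
  show ?thesis
  proof (rule fps_ext)
    fix n
    have "fps_nth (\<eta> ?L) n = fps_nth (\<eta> ?R) n" using \<open>\<eta> ?L = \<eta> ?R\<close> by (rule arg_cong)
    then show "fps_nth ?L n = fps_nth ?R n"
      by (simp only: \<eta>_def fps_map_def fps_nth_Abs_fps fps_of_poly_eq_iff)
  qed
qed

lemma poly_at_sum_monom: "poly_at (\<Sum>s=0..j. monom (c s) s) g = (\<Sum>s=0..j. fps_const [:c s:] * g ^ s)"
proof -
  have *: "map_poly (\<lambda>c. fps_const [:c:]) (\<Sum>s=0..j. monom (c s) s) = (\<Sum>s=0..j. monom (fps_const [:c s:]) s)"
    by (rule poly_eqI) (simp add: coeff_map_poly coeff_sum if_distrib[where f = "\<lambda>c. fps_const [:c:]"] cong: if_cong)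
  show ?thesis unfolding poly_at_def * by (simp add: poly_sum poly_monom)
qed

text \<open>The condition \<open>2 * s \<le> n\<close> leaves enough factors \<open>p\<close> to
  absorb every inverse; this is what makes \<open>A_gf\<close> a polynomial in
  \<open>W\<close>.\<close>

lemma homogenise_unit_inverse:
  assumes "fps_nth p 0 = 1" "2 * s \<le> (n::nat)"
  shows "p ^ n * (a * unit_inverse (p\<^sup>2)) ^ s = a ^ s * p ^ (n - 2 * s)"
proof -
  have "p ^ n = p ^ (n - 2 * s) * (p\<^sup>2) ^ s" using assms(2) by (simp flip: power_mult power_add)
  then have "p ^ n * (a * unit_inverse (p\<^sup>2)) ^ s = a ^ s * p ^ (n - 2 * s) * (p\<^sup>2 * unit_inverse (p\<^sup>2)) ^ s"
    by (simp only: power_mult_distrib mult_ac)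
  also have "p\<^sup>2 * unit_inverse (p\<^sup>2) = 1"
    by (rule unit_inverse_right) (use assms(1) in \<open>simp add: power2_eq_square\<close>)
  finally show ?thesis by simp
qed

lemma A_gf_expansion:
  assumes "P j = (\<Sum>s=0..j. monom (e s) s)"
  shows "A_gf j = (\<Sum>s=0..j. fps_const [:e s:] * xs ^ s * (1 + 4 * xs * W) ^ (2 * j - 2 * s) * (1 + 2 * W + 4 * xs * W\<^sup>2) ^ s)"
proof -
  define p where "p = 1 + 4 * xs * W"
  define u where "u = 1 + 2 * W + 4 * xs * W\<^sup>2"
  have "fps_nth p 0 = 1" unfolding p_def by simp
  then have h: "p ^ (2 * j) * (xs * u * unit_inverse (p\<^sup>2)) ^ s = (xs * u) ^ s * p ^ (2 * j - 2 * s)" if "s \<le> j" for s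
    using homogenise_unit_inverse[of p s "2 * j" "xs * u"] that by simp
  have "p ^ (2 * j) * (fps_const [:e s:] * (xs * u * unit_inverse (p\<^sup>2)) ^ s)
    = fps_const [:e s:] * xs ^ s * p ^ (2 * j - 2 * s) * u ^ s" if "s \<le> j" for s
    by (simp only: mult.left_commute[of "p ^ (2 * j)"] h[OF that]) (simp only: power_mult_distrib mult_ac)
  then show ?thesis
    unfolding A_gf_def assms poly_at_sum_monom sum_distrib_left p_def[symmetric] u_def[symmetric]
    by (intro sum.cong refl) simp
qed

lemma Abs_fps_A: "Abs_fps (\<lambda>r. A j r) = A_gf j"
  unfolding A_def by (rule fps_nth_inverse)

section \<open>Series with natural coefficients\<close>

definition nat_coeffs :: "rat poly fps \<Rightarrow> bool" where
  "nat_coeffs g \<longleftrightarrow> (\<forall>r i. coeff (fps_nth g r) i \<in> \<nat>)"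

lemma nat_coeffs_add: "nat_coeffs a \<Longrightarrow> nat_coeffs b \<Longrightarrow> nat_coeffs (a + b)"
  unfolding nat_coeffs_def by simp

lemma nat_coeffs_mult: "nat_coeffs a \<Longrightarrow> nat_coeffs b \<Longrightarrow> nat_coeffs (a * b)"
proof -
  have "(\<Sum>i\<in>S. f i) \<in> \<nat>" if "\<And>i. f i \<in> \<nat>" for f :: "nat \<Rightarrow> rat" and S
    using that by (induction S rule: infinite_finite_induct) auto
  then show "nat_coeffs a \<Longrightarrow> nat_coeffs b \<Longrightarrow> nat_coeffs (a * b)"
    unfolding nat_coeffs_def by (simp add: fps_mult_nth coeff_sum coeff_mult)
qed

lemma nat_coeffs_const: "(\<And>i. coeff p i \<in> \<nat>) \<Longrightarrow> nat_coeffs (fps_const p)"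
  unfolding nat_coeffs_def by simp

lemma nat_coeffs_basic: "nat_coeffs 1" "nat_coeffs W" "nat_coeffs xs" "nat_coeffs (numeral n)"
  by (auto simp: nat_coeffs_def coeff_pCons numeral_fps_const one_pCons numeral_poly split: nat.split)

lemma nat_coeffs_power: "nat_coeffs a \<Longrightarrow> nat_coeffs (a ^ m)"
  by (induction m) (auto intro: nat_coeffs_mult nat_coeffs_basic)

lemma nat_coeffs_sum: "(\<And>i. i \<in> S \<Longrightarrow> nat_coeffs (f i)) \<Longrightarrow> nat_coeffs (\<Sum>i\<in>S. f i)"
  by (induction S rule: infinite_finite_induct) (auto intro: nat_coeffs_add simp: nat_coeffs_def)

text \<open>The coefficients of \<open>Abs_fps G\<close> are evaluated at \<open>t\<close>, those of
  \<open>A_gf j\<close> at \<open>x = t / (1 + t)^2\<close>. The weight \<open>y^f\<close> of the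
  binomial transform and the factor \<open>y^(2j)\<close> together form the prefactor
  \<open>(1 + t)^(2j + f)\<close> of a gamma expansion.\<close>

lemma binomial_sum_is_gamma_poly:
  fixes G :: "nat \<Rightarrow> rat poly" and e :: "nat \<Rightarrow> rat"
  assumes G: "(1 - fps_const [:1, 1:] * fps_X) ^ (2 * j + 1) * Abs_fps G
    = (\<Sum>s=0..j. fps_const [:e s:] * (fps_const [:0, 1:] * (1 - fps_const ([:1, -1:]\<^sup>2) * fps_X\<^sup>2)) ^ s 
         * (fps_const [:1, 1:] - fps_const ([:1, -1:]\<^sup>2) * fps_X) ^ (2 * j - 2 * s))"
    and A: "A_gf j = (\<Sum>s=0..j. fps_const [:e s:] * xs ^ s * (1 + 4 * xs * W) ^ (2 * j - 2 * s) * (1 + 2 * W + 4 * xs * W\<^sup>2) ^ s)"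
  shows "is_gamma_poly (2 * j + f) (G f) (\<Sum>r=0..f. of_nat (f choose r) * A j r)"
  unfolding is_gamma_poly_def
proof (intro allI impI)
  fix t :: rat assume "t \<noteq> -1"
  define y where "y = 1 + t"
  then have y: "y \<noteq> 0" using \<open>t \<noteq> -1\<close> by (metis add_eq_0_iff)
  define x where "x = t / y\<^sup>2"
  have yx: "y\<^sup>2 * x = t" unfolding x_def using y by simp
  define \<epsilon> where "\<epsilon> = (\<lambda>u. fps_map (\<lambda>p :: rat poly. poly p u))"
  have \<epsilon>: "fps_map (\<lambda>p. poly p u) = \<epsilon> u" for u unfolding \<epsilon>_def ..
  note hom = fps_map_hom[of "\<lambda>p. poly p (u :: rat)" for u, OF poly_add poly_mult poly_1, unfolded \<epsilon>]
  let ?z = "fps_X :: rat fps"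
  let ?Y = "fps_const y * ?z"
  let ?B = "binomial_transform y"
  define p where "p = 1 + fps_const (4 * x) * ?z"
  define q where "q = 1 + 2 * ?z + fps_const (4 * x) * ?z\<^sup>2"
  define a where "a = \<epsilon> x (A_gf j)"
  have 4: "4 * fps_const x = fps_const (4 * x)" by (simp add: numeral_fps_const)
  have a: "a = (\<Sum>s=0..j. fps_const (e s * x ^ s) * (p ^ (2 * j - 2 * s) * q ^ s))"
  proof -
    have "poly [:0, 1:] x = x" "poly [:d:] x = d" for d by simp_all
    then have "a = (\<Sum>s=0..j. fps_const (e s) * fps_const x ^ s * p ^ (2 * j - 2 * s) * q ^ s)"
      unfolding a_def A p_def q_def 4[symmetric] by (simp only: hom)
    then show ?thesis by (simp only: fps_const_mult[symmetric] fps_const_power[symmetric] mult.assoc)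
  qed
  have "(1 - ?Y) ^ (2 * j + 1) * (fps_const (y ^ (2 * j)) * ?B a)
     = (\<Sum>s=0..j. fps_const (e s) * (fps_const (y ^ (2 * j) * x ^ s) * ((1 - ?Y) ^ (2 * j + 1) * ?B (p ^ (2 * j - 2 * s) * q ^ s))))"
    unfolding a binomial_transform_sum binomial_transform_const_mult sum_distrib_left
    by (intro sum.cong refl) (simp only: mult_ac fps_const_mult[symmetric])
  also have "\<dots> = (\<Sum>s=0..j. fps_const (e s) * ((fps_const t * (1 - fps_const ((1 - t)\<^sup>2) * ?z\<^sup>2)) ^ s 
         * (fps_const y - fps_const ((1 - t)\<^sup>2) * ?z) ^ (2 * j - 2 * s)))"
  proof (rule sum.cong[OF refl], rule arg_cong2[where f = "(*)", OF refl])
    fix s assume s: "s \<in> {0..j}"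
    let ?m = "2 * j - 2 * s"
    have "2 * j + 1 = ?m + 2 * s + 1" using s by auto
    then have 1: "(1 - ?Y) ^ (2 * j + 1) * ?B (p ^ ?m * q ^ s) = (1 - ?Y + fps_const (4 * x) * ?Y) ^ ?m
       * ((1 - ?Y)\<^sup>2 + 2 * ?Y * (1 - ?Y) + fps_const (4 * x) * ?Y\<^sup>2) ^ s"
      using binomial_transform_powers[of y ?m s x] unfolding p_def q_def by simp
    have "y ^ (2 * j) = y ^ ?m * (y\<^sup>2) ^ s" using s by (simp flip: power_mult power_add)
    then have "y ^ (2 * j) * x ^ s = y ^ ?m * t ^ s" by (simp only: mult.assoc power_mult_distrib[symmetric] yx)
    then have 2: "fps_const (y ^ (2 * j) * x ^ s) = fps_const y ^ ?m * fps_const t ^ s"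
      by simp
    \<comment> \<open>The origin of the constant \<open>4\<close> in \<open>A_gf\<close>: as
      \<open>y^2 x = t\<close>, the term with \<open>4 * x\<close> completes \<open>- y^2\<close> to
      \<open>- (1 - t)^2\<close>.\<close>
    have t: "(1 - t)\<^sup>2 = y\<^sup>2 - 4 * t" unfolding y_def by (simp add: power2_eq_square algebra_simps)
    have 3: "fps_const y * (1 - ?Y + fps_const (4 * x) * ?Y) = fps_const y - fps_const ((1 - t)\<^sup>2) * ?z"
    proof -
      have "fps_const y * (1 - ?Y + fps_const (4 * x) * ?Y) = fps_const y - fps_const (y * y) * ?z + fps_const (4 * (y\<^sup>2 * x)) * ?z"
        by (simp only: fps_const_mult[symmetric] power2_eq_square) (simp only: algebra_simps mult_1_left)
      then show ?thesis unfolding yx t by (simp only: power2_eq_square algebra_simps fps_const_sub[symmetric])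
    qed
    \<comment> \<open>The origin of the term \<open>2 * W\<close> in \<open>A_gf\<close>:
      \<open>(1 - Y)^2 + 2 Y (1 - Y) = 1 - Y^2\<close> has no linear term.\<close>
    have 4: "(1 - ?Y)\<^sup>2 + 2 * ?Y * (1 - ?Y) + fps_const (4 * x) * ?Y\<^sup>2 = 1 - fps_const ((1 - t)\<^sup>2) * ?z\<^sup>2"
    proof -
      have "(1 - ?Y)\<^sup>2 + 2 * ?Y * (1 - ?Y) + fps_const (4 * x) * ?Y\<^sup>2 = 1 - fps_const (y\<^sup>2) * ?z\<^sup>2 + fps_const (4 * (y\<^sup>2 * x)) * ?z\<^sup>2"
        by (simp only: fps_const_mult[symmetric] power2_eq_square) (simp only: algebra_simps mult_1_left mult_2 mult_2_right)
      then show ?thesis unfolding yx t by (simp only: algebra_simps fps_const_sub[symmetric])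
    qed
    show "fps_const (y ^ (2 * j) * x ^ s) * ((1 - ?Y) ^ (2 * j + 1) * ?B (p ^ ?m * q ^ s))
      = (fps_const t * (1 - fps_const ((1 - t)\<^sup>2) * ?z\<^sup>2)) ^ s * (fps_const y - fps_const ((1 - t)\<^sup>2) * ?z) ^ ?m"
      unfolding 1 2 4 unfolding 3[symmetric] power_mult_distrib by (simp only: mult_ac)
  qed
  also have "\<dots> = \<epsilon> t ((1 - fps_const [:1, 1:] * fps_X) ^ (2 * j + 1) * Abs_fps G)"
  proof -
    have "poly [:0, 1:] t = t" "poly [:1, 1:] t = y" "poly ([:1, -1:]\<^sup>2) t = (1 - t)\<^sup>2" "poly [:d:] t = d" for d
      by (simp_all add: y_def)
    then show ?thesis unfolding G by (simp only: hom mult.assoc)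
  qed
  also have "\<dots> = (1 - ?Y) ^ (2 * j + 1) * \<epsilon> t (Abs_fps G)"
  proof -
    have "poly [:1, 1:] t = y" by (simp add: y_def)
    then show ?thesis by (simp only: hom)
  qed
  finally have "(1 - ?Y) ^ (2 * j + 1) * (fps_const (y ^ (2 * j)) * ?B a) = (1 - ?Y) ^ (2 * j + 1) * \<epsilon> t (Abs_fps G)" .
  moreover have "(1 - ?Y) ^ (2 * j + 1) \<noteq> 0"
  proof -
    have "fps_nth (1 - ?Y) 0 \<noteq> fps_nth 0 0" by simp
    then have "1 - ?Y \<noteq> 0" by metis
    then show ?thesis by (rule power_not_zero)
  qed
  ultimately have "fps_const (y ^ (2 * j)) * ?B a = \<epsilon> t (Abs_fps G)"
    by (metis mult_left_cancel)
  then have "fps_nth (fps_const (y ^ (2 * j)) * ?B a) f = fps_nth (\<epsilon> t (Abs_fps G)) f" by simp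
  then have "y ^ (2 * j) * (y ^ f * (\<Sum>r=0..f. of_nat (f choose r) * poly (A j r) x)) = poly (G f) t"
    unfolding \<epsilon>_def fps_map_def a_def binomial_transform_def A_def by simp
  then show "poly (G f) t = (1 + t) ^ (2 * j + f) * poly (\<Sum>r=0..f. of_nat (f choose r) * A j r) (t / (1 + t)\<^sup>2)"
    unfolding y_def x_def by (simp add: poly_sum power_add mult.assoc)
qed

section \<open>Words, labellings and descents\<close>

lemma act_minus: "act w (- i) = - act w i"
  by (simp add: act_def sgn_minus)

lemma act_0 [simp]: "act w 0 = 0"
  by (simp add: act_def)

lemma act_Suc: "act w (int i + 1) = w ! i"
  by (simp add: act_def nat_add_distrib)

lemma act_map:
  assumes "\<And>i. i \<in> {- int n..int n} \<Longrightarrow> h (- i) = - h i" "i \<in> {- int n..int n}"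
  shows "act (map h [1..int n]) i = h i"
proof -
  have pos: "act (map h [1..int n]) i = h i" if "i \<in> {1..int n}" for i
  proof -
    have "i = int (nat (i - 1)) + 1" "nat (i - 1) < n" using that by auto
    then obtain m where m: "i = int m + 1" "m < n" by blast
    have "map h [1..int n] ! m = h i" using m nth_upto[of 1 m "int n"] by (simp add: add.commute)
    then show ?thesis unfolding m act_Suc by (simp add: m)
  qed
  have "h 0 = 0" using assms(1)[of 0] by simp
  then show ?thesis using pos[of i] pos[of "- i"] assms by (cases i "0::int" rule: linorder_cases) (auto simp: act_minus)
qed

lemma act_append:
  assumes "\<bar>i\<bar> \<le> int (length w)"
  shows "act (w @ v) i = act w i"
  using assms unfolding act_def nth_append by auto

lemma word_eqI:
  assumes "length v = n" "length w = n" "\<And>i. i \<in> {1..int n} \<Longrightarrow> act v i = act w i"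
  shows "v = w"
proof (rule nth_equalityI)
  fix i assume "i < length v"
  then show "v ! i = w ! i" using assms(1) assms(3)[of "int i + 1"] by (simp add: act_Suc)
qed (use assms in simp)

text \<open>The convention \<open>act l 0 = 0\<close> supplies the initial label. The bound is an
  integer because the recursion lowers it by one at a strict step, possibly to \<open>-1\<close>,
  where no chain exists.\<close>

definition bounded_chains :: "(nat \<Rightarrow> bool) \<Rightarrow> nat \<Rightarrow> int \<Rightarrow> int list set" where
  "bounded_chains d n k = {l. length l = n \<and> (\<forall>i<n. act l (int i) + of_bool (d i) \<le> act l (int i + 1)) \<and> act l (int n) \<le> k}"

lemma bounded_chains_0: "bounded_chains d 0 k = (if k \<ge> 0 then {[]} else {})"
  by (auto simp: bounded_chains_def)

lemma bounded_chains_Suc: "bounded_chains d (Suc n) k = (\<Union>m\<in>{..k}. (\<lambda>l. l @ [m]) ` bounded_chains d n (m - of_bool (d n)))"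
proof (intro set_eqI iffI)
  fix l assume l: "l \<in> bounded_chains d (Suc n) k"
  then have "length l = Suc n" by (simp add: bounded_chains_def)
  then obtain v m where v: "l = v @ [m]" "length v = n" by (metis length_Suc_conv_rev)
  have "act l (int n + 1) = m" using v by (simp add: act_Suc nth_append)
  moreover have "act l (int i) = act v (int i)" if "i \<le> n" for i
    using that v act_append by simp
  moreover have "act l (int i + 1) = act v (int i + 1)" if "i < n" for i
    using that v act_append by simp
  ultimately have "v \<in> bounded_chains d n (m - of_bool (d n))" "m \<le> k"
    using l v(2) unfolding bounded_chains_def by (auto simp: less_Suc_eq add.commute[of 1])
  then show "l \<in> (\<Union>m\<in>{..k}. (\<lambda>l. l @ [m]) ` bounded_chains d n (m - of_bool (d n)))" using v(1) by blast
next
  fix l assume "l \<in> (\<Union>m\<in>{..k}. (\<lambda>l. l @ [m]) ` bounded_chains d n (m - of_bool (d n)))"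
  then obtain v m where v: "l = v @ [m]" "v \<in> bounded_chains d n (m - of_bool (d n))" "m \<le> k" by auto
  then have "length v = n" by (simp add: bounded_chains_def)
  have "act l (int n + 1) = m" using v \<open>length v = n\<close> by (simp add: act_Suc nth_append)
  moreover have "act l (int i) = act v (int i)" if "i \<le> n" for i
    using that v \<open>length v = n\<close> act_append by simp
  moreover have "act l (int i + 1) = act v (int i + 1)" if "i < n" for i
    using that v \<open>length v = n\<close> act_append by simp
  ultimately show "l \<in> bounded_chains d (Suc n) k"
    using v unfolding bounded_chains_def by (auto simp: less_Suc_eq add.commute[of 1])
qed

lemma bounded_chains_neg: "k < 0 \<Longrightarrow> bounded_chains d n k = {}"
  by (induction n arbitrary: k) (auto simp: bounded_chains_0 bounded_chains_Suc)

text \<open>Chains start at \<open>0\<close> and never decrease, so negative last labels contribute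
  nothing and the union becomes finite, ready for counting.\<close>

lemma bounded_chains_Suc': "bounded_chains d (Suc n) k = (\<Union>m\<in>{0..k}. (\<lambda>l. l @ [m]) ` bounded_chains d n (m - of_bool (d n)))"
proof -
  have "m \<ge> 0" if "l \<in> bounded_chains d n (m - of_bool (d n))" for l m
  proof (rule ccontr)
    assume "\<not> m \<ge> 0"
    then have "bounded_chains d n (m - of_bool (d n)) = {}" by (intro bounded_chains_neg) simp
    then show False using that by simp
  qed
  then show ?thesis unfolding bounded_chains_Suc by fastforce
qed

lemma finite_bounded_chains: "finite (bounded_chains d n k)"
  by (induction n arbitrary: k) (auto simp: bounded_chains_0 bounded_chains_Suc')

lemma card_bounded_chains_Suc: "card (bounded_chains d (Suc n) (int k)) = (\<Sum>m=0..k. card (bounded_chains d n (int m - of_bool (d n))))"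
proof -
  have "card (bounded_chains d (Suc n) (int k)) = (\<Sum>m\<in>{0..int k}. card ((\<lambda>l. l @ [m]) ` bounded_chains d n (m - of_bool (d n))))"
    unfolding bounded_chains_Suc' by (rule card_UN_disjoint) (auto simp: finite_bounded_chains)
  also have "\<dots> = (\<Sum>m\<in>{0..int k}. card (bounded_chains d n (m - of_bool (d n))))"
    by (simp add: card_image inj_on_def)
  also have "\<dots> = (\<Sum>m=0..k. card (bounded_chains d n (int m - of_bool (d n))))"
    by (rule sum.reindex_bij_witness[of _ int nat]) auto
  finally show ?thesis .
qed

text \<open>The last label \<open>m\<close> is peeled off: summing over \<open>m <= k\<close> is
  division by \<open>1 - t\<close>, and a strict step shifts the bound, which is a factor
  \<open>t\<close>.\<close>

lemma bounded_chains_gf: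
  "(1 - fps_X) ^ (n + 1) * Abs_fps (\<lambda>k. of_nat (card (bounded_chains d n (int k)))) = (fps_X ^ card {i. i < n \<and> d i} :: rat fps)"
proof (induction n)
  case 0
  show ?case 
  proof (rule fps_ext)
    show "fps_nth ((1 - fps_X) ^ (0 + 1) * Abs_fps (\<lambda>k. of_nat (card (bounded_chains d 0 (int k))))) m 
      = fps_nth (fps_X ^ card {i. i < 0 \<and> d i} :: rat fps) m" for m
      by (cases m) (simp_all add: bounded_chains_0 left_diff_distrib)
  qed
next
  case (Suc n)
  let ?a = "\<lambda>n. Abs_fps (\<lambda>k. of_nat (card (bounded_chains d n (int k)))) :: rat fps"
  have "(1 - fps_X) * ?a (Suc n) = Abs_fps (\<lambda>k. of_nat (card (bounded_chains d n (int k - of_bool (d n)))))"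
  proof (rule fps_ext)
    show "fps_nth ((1 - fps_X) * ?a (Suc n)) m = fps_nth (Abs_fps (\<lambda>k. of_nat (card (bounded_chains d n (int k - of_bool (d n)))))) m" for m
      unfolding card_bounded_chains_Suc by (cases m) (simp_all add: left_diff_distrib)
  qed
  also have "\<dots> = fps_X ^ of_bool (d n) * ?a n"
  proof (rule fps_ext)
    show "fps_nth (Abs_fps (\<lambda>k. of_nat (card (bounded_chains d n (int k - of_bool (d n)))))) m = fps_nth (fps_X ^ of_bool (d n) * ?a n) m" for m
      by (cases m) (simp_all add: bounded_chains_neg)
  qed
  finally have "(1 - fps_X) ^ (Suc n + 1) * ?a (Suc n) = fps_X ^ of_bool (d n) * fps_X ^ card {i. i < n \<and> d i}"
    unfolding Suc.IH[symmetric] by (simp add: mult_ac)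
  moreover have "{i. i < Suc n \<and> d i} = {i. i < n \<and> d i} \<union> (if d n then {n} else {})"
    by (auto simp: less_Suc_eq)
  then have "card {i. i < Suc n \<and> d i} = of_bool (d n) + card {i. i < n \<and> d i}"
    by simp
  ultimately show ?case by (simp add: power_add)
qed

definition labellings :: "int list \<Rightarrow> int \<Rightarrow> int list set" where
  "labellings w = bounded_chains (\<lambda>i. act w (int i) > act w (int i + 1)) (length w)"

lemma labellings_gf:
  "(1 - fps_X) ^ (length w + 1) * Abs_fps (\<lambda>k. of_nat (card (labellings w (int k)))) = (fps_X ^ desB w :: rat fps)"
proof -
  have "bij_betw int {i. i < length w \<and> act w (int i) > act w (int i + 1)} {i \<in> {0..<int (length w)}. act w i > act w (i + 1)}"
    by (rule bij_betw_byWitness[of _ nat]) auto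
  then have "card {i. i < length w \<and> act w (int i) > act w (int i + 1)} = desB w"
    unfolding desB_def by (rule bij_betw_same_card)
  then show ?thesis unfolding labellings_def bounded_chains_gf by simp
qed

section \<open>Signed involutions as functions\<close>

definition odd_involution :: "nat \<Rightarrow> (int \<Rightarrow> int) \<Rightarrow> bool" where
  "odd_involution n p \<longleftrightarrow> (\<forall>i\<in>{- int n..int n}. p i \<in> {- int n..int n} \<and> p (p i) = i \<and> p (- i) = - p i)"

text \<open>For the converse, oddness makes \<open>i \<mapsto> \<bar>act w i\<bar>\<close> an
  involution of \<open>{1..int n}\<close>, hence the permutation that \<open>signed_perms\<close>
  asks for.\<close>

lemma involutionsB_iff: "w \<in> involutionsB n \<longleftrightarrow> length w = n \<and> odd_involution n (act w)"
proof
  assume w: "w \<in> involutionsB n"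
  then have len: "length w = n" and abs: "abs ` set w = {1..int n}" and inv: "\<And>i. i \<in> {- int n..int n} \<Longrightarrow> act w (act w i) = i"
    by (auto simp: involutionsB_def signed_perms_def)
  have pos: "act w i \<in> {- int n..int n}" if i: "i \<in> {1..int n}" for i
  proof -
    have "act w i = w ! (nat i - 1)" "nat i - 1 < length w" using i len by (auto simp: act_def)
    then have "\<bar>act w i\<bar> \<in> abs ` set w" by (metis imageI nth_mem)
    then show ?thesis unfolding abs by auto
  qed
  have "act w i \<in> {- int n..int n}" if "i \<in> {- int n..int n}" for i
    using that pos[of i] pos[of "- i"] by (cases i "0::int" rule: linorder_cases) (auto simp: act_minus)
  then show "length w = n \<and> odd_involution n (act w)"
    using len inv by (auto simp: odd_involution_def act_minus)
next
  assume w: "length w = n \<and> odd_involution n (act w)"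
  then have len: "length w = n" and inv: "\<And>i. i \<in> {- int n..int n} \<Longrightarrow> act w (act w i) = i"
    and cl: "\<And>i. i \<in> {- int n..int n} \<Longrightarrow> act w i \<in> {- int n..int n}"
    unfolding odd_involution_def by auto
  have mw: "map abs w = map (\<lambda>i. \<bar>act w (int i + 1)\<bar>) [0..<n]"
    using len by (intro nth_equalityI) (auto simp: act_Suc)
  have inv2: "\<bar>act w \<bar>act w i\<bar>\<bar> = i" if "i \<in> {1..int n}" for i
  proof -
    have "act w (act w i) = i" using inv that by auto
    then show ?thesis using that by (cases "act w i < 0") (auto simp: act_minus)
  qed
  have "inj_on (\<lambda>i. \<bar>act w (int i + 1)\<bar>) {0..<n}"
  proof (rule inj_onI)
    fix i j assume "i \<in> {0..<n}" "j \<in> {0..<n}" "\<bar>act w (int i + 1)\<bar> = \<bar>act w (int j + 1)\<bar>"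
    moreover from this have "int i + 1 \<in> {1..int n}" "int j + 1 \<in> {1..int n}" by auto
    ultimately have "int i + 1 = int j + 1" using inv2 by metis
    then show "i = j" by simp
  qed
  then have "distinct (map abs w)" unfolding mw by (simp add: distinct_map)
  moreover have nz: "act w i \<noteq> 0" if "i \<in> {1..int n}" for i
    using inv[of i] that by auto
  have "abs ` set w = {1..int n}"
  proof -
    have "abs ` set w = (\<lambda>i. \<bar>act w (int i + 1)\<bar>) ` {0..<n}"
      using arg_cong[OF mw, of set] by simp
    also have "\<dots> = {1..int n}"
    proof (intro equalityI subsetI)
      fix x assume "x \<in> (\<lambda>i. \<bar>act w (int i + 1)\<bar>) ` {0..<n}"
      then obtain i where i: "i < n" "x = \<bar>act w (int i + 1)\<bar>" by auto
      then show "x \<in> {1..int n}" using cl[of "int i + 1"] nz[of "int i + 1"] by auto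
    next
      fix x assume x: "x \<in> {1..int n}"
      let ?i = "\<bar>act w x\<bar>"
      have "?i \<in> {1..int n}" using x cl[of x] nz[of x] by auto
      then have "x = \<bar>act w (int (nat (?i - 1)) + 1)\<bar>" "nat (?i - 1) < n" using inv2[OF x] by auto
      then show "x \<in> (\<lambda>i. \<bar>act w (int i + 1)\<bar>) ` {0..<n}" by (intro image_eqI) simp_all
    qed
    finally show ?thesis .
  qed
  ultimately show "w \<in> involutionsB n"
    using w inv by (simp add: involutionsB_def signed_perms_def)
qed

lemma finite_involutionsB: "finite (involutionsB n)"
proof (rule finite_subset)
  show "involutionsB n \<subseteq> {w. set w \<subseteq> {- int n..int n} \<and> length w = n}"
  proof safe
    fix w x assume w: "w \<in> involutionsB n" "x \<in> set w"
    then have "\<bar>x\<bar> \<in> {1..int n}" unfolding involutionsB_def signed_perms_def by blast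
    then show "x \<in> {- int n..int n}" by auto
  qed (simp add: involutionsB_iff)
  show "finite {w. set w \<subseteq> {- int n..int n} \<and> length w = n}"
    by (rule finite_lists_length_eq) simp
qed

text \<open>Each two-cycle is counted by its smaller element in \<open>U\<close>, and
  \<open>?p\<close> carries \<open>U\<close> onto the set \<open>V\<close> of larger
  elements.\<close>

lemma two_cyc2_plus_fixB:
  assumes "w \<in> involutionsB n"
  shows "2 * cyc2 w + fixB w = n"
proof -
  let ?p = "\<lambda>i. \<bar>act w i\<bar>"
  have len: "length w = n" and odd: "odd_involution n (act w)" using assms involutionsB_iff by auto
  have p: "?p i \<in> {1..int n}" "?p (?p i) = i" if "i \<in> {1..int n}" for i
  proof -
    have *: "act w (act w i) = i" "act w i \<in> {- int n..int n}" using odd that unfolding odd_involution_def by auto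
    then show "?p (?p i) = i" using that by (cases "act w i < 0") (auto simp: act_minus)
    have "act w i \<noteq> 0" using * that by auto
    then show "?p i \<in> {1..int n}" using * by auto
  qed
  define U where "U = {i \<in> {1..int n}. i < ?p i}"
  define V where "V = {i \<in> {1..int n}. ?p i < i}"
  have fin: "finite {i. 1 \<le> i \<and> i \<le> int n \<and> Q i}" for Q
    by (rule finite_subset[of _ "{1..int n}"]) auto
  have "bij_betw ?p U V"
    by (rule bij_betw_byWitness[of _ ?p]) (use p in \<open>auto simp: U_def V_def\<close>)
  then have UV: "card U = card V" by (rule bij_betw_same_card)
  have "{{i, ?p i} | i. i \<in> {1..int n} \<and> ?p i \<noteq> i} = (\<lambda>i. {i, ?p i}) ` U"
  proof (intro equalityI subsetI)
    fix e assume "e \<in> {{i, ?p i} | i. i \<in> {1..int n} \<and> ?p i \<noteq> i}"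
    then obtain i where i: "e = {i, ?p i}" "i \<in> {1..int n}" "?p i \<noteq> i" by auto
    show "e \<in> (\<lambda>i. {i, ?p i}) ` U"
    proof (cases "i < ?p i")
      case False
      then have "?p i \<in> U" using i p[OF i(2)] by (auto simp: U_def)
      moreover have "e = {?p i, ?p (?p i)}" using i p[OF i(2)] by auto
      ultimately show ?thesis by blast
    qed (use i in \<open>auto simp: U_def\<close>)
  qed (auto simp: U_def)
  moreover have "inj_on (\<lambda>i. {i, ?p i}) U"
    by (rule inj_onI) (auto simp: U_def doubleton_eq_iff)
  ultimately have "cyc2 w = card U" unfolding cyc2_def len by (simp add: card_image)
  moreover have "{1..int n} = (U \<union> V) \<union> {i \<in> {1..int n}. ?p i = i}" by (auto simp: U_def V_def)
  then have "card {1..int n} = card ((U \<union> V) \<union> {i \<in> {1..int n}. ?p i = i})" by (rule arg_cong)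
  then have "n = card (U \<union> V) + fixB w" unfolding fixB_def len
    by (subst (asm) card_Un_disjoint) (use fin in \<open>auto simp: U_def V_def\<close>)
  moreover have "card (U \<union> V) = card U + card V"
    by (rule card_Un_disjoint) (use fin in \<open>auto simp: U_def V_def\<close>)
  ultimately show ?thesis using UV by simp
qed

section \<open>Ranks in finite linear orders\<close>

definition rank :: "'a::linorder set \<Rightarrow> 'a \<Rightarrow> nat" where
  "rank S x = card {y \<in> S. y < x}"

lemma rank_less:
  assumes "finite S" "x \<in> S" "x < y"
  shows "rank S x < rank S y"
  unfolding rank_def by (rule psubset_card_mono) (use assms in auto)

lemma bij_betw_rank:
  assumes "finite S"
  shows "bij_betw (rank S) S {..<card S}"
proof -
  have inj: "inj_on (rank S) S"
    by (rule inj_onI) (metis assms rank_less less_irrefl linorder_neq_iff)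
  have "rank S x < card S" if "x \<in> S" for x
    unfolding rank_def by (rule psubset_card_mono) (use assms that in auto)
  then have "rank S ` S \<subseteq> {..<card S}" by auto
  then have "rank S ` S = {..<card S}" by (rule card_subset_eq[rotated]) (simp_all add: card_image inj)
  with inj show ?thesis unfolding bij_betw_def by simp
qed

text \<open>Exactly the images of the \<open>i + n\<close> positions \<open>-n, ..., i - 1\<close>
  lie below \<open>\<phi> i\<close>. The rank does not depend on \<open>\<phi>\<close>, so
  increasing enumerations are unique.\<close>

lemma rank_strict_mono_image:
  fixes \<phi> :: "int \<Rightarrow> 'a::linorder"
  assumes bij: "bij_betw \<phi> {- int n..int n} S"
    and mono: "\<And>i j. i \<in> {- int n..int n} \<Longrightarrow> j \<in> {- int n..int n} \<Longrightarrow> i < j \<Longrightarrow> \<phi> i < \<phi> j"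
    and i: "i \<in> {- int n..int n}"
  shows "int (rank S (\<phi> i)) = i + int n"
proof -
  have "\<phi> j < \<phi> i \<longleftrightarrow> j < i" if "j \<in> {- int n..int n}" for j
    using mono[of j i] mono[of i j] that i by (metis less_asym less_irrefl linorder_neq_iff)
  then have "{y \<in> S. y < \<phi> i} = \<phi> ` {- int n..<i}"
    using bij i unfolding bij_betw_def by auto
  moreover have "inj_on \<phi> {- int n..<i}"
    using bij i unfolding bij_betw_def by (auto intro: inj_on_subset)
  ultimately show ?thesis unfolding rank_def using i by (simp add: card_image)
qed

lemma strict_mono_bij_unique:
  fixes \<phi> \<psi> :: "int \<Rightarrow> 'a::linorder"
  assumes "finite S" "bij_betw \<phi> {- int n..int n} S" "bij_betw \<psi> {- int n..int n} S"
    and "\<And>i j. i \<in> {- int n..int n} \<Longrightarrow> j \<in> {- int n..int n} \<Longrightarrow> i < j \<Longrightarrow> \<phi> i < \<phi> j"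
    and "\<And>i j. i \<in> {- int n..int n} \<Longrightarrow> j \<in> {- int n..int n} \<Longrightarrow> i < j \<Longrightarrow> \<psi> i < \<psi> j"
    and i: "i \<in> {- int n..int n}"
  shows "\<phi> i = \<psi> i"
proof -
  have "rank S (\<phi> i) = rank S (\<psi> i)"
    using rank_strict_mono_image[OF assms(2,4) i] rank_strict_mono_image[OF assms(3,5) i] by simp
  moreover have "\<phi> i \<in> S" "\<psi> i \<in> S" using assms(2,3) i by (auto simp: bij_betw_def)
  ultimately show ?thesis using bij_betw_rank[OF assms(1)] by (auto simp: bij_betw_def inj_on_def)
qed

text \<open>\<open>\<tau>\<close> exchanges the points below their image with those above it, so the
  fixed points have the parity of \<open>card S\<close>; two fixed points \<open>i < j\<close> would
  contradict that \<open>\<tau>\<close> is decreasing.\<close>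

lemma decreasing_involution_fixpoints:
  fixes \<tau> :: "int \<Rightarrow> int"
  assumes fin: "finite S" and cl: "\<And>i. i \<in> S \<Longrightarrow> \<tau> i \<in> S" and inv: "\<And>i. i \<in> S \<Longrightarrow> \<tau> (\<tau> i) = i"
    and dec: "\<And>i j. i \<in> S \<Longrightarrow> j \<in> S \<Longrightarrow> i < j \<Longrightarrow> \<tau> j < \<tau> i"
  shows "card {i \<in> S. \<tau> i = i} = card S mod 2"
proof -
  define U where "U = {i \<in> S. i < \<tau> i}"
  define V where "V = {i \<in> S. \<tau> i < i}"
  define Z where "Z = {i \<in> S. \<tau> i = i}"
  have "bij_betw \<tau> U V"
    by (rule bij_betw_byWitness[of _ \<tau>]) (use cl inv in \<open>auto simp: U_def V_def\<close>)
  then have UV: "card U = card V" by (rule bij_betw_same_card)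
  have "\<forall>i\<in>Z. \<forall>j\<in>Z. i = j"
    using dec unfolding Z_def by (metis (mono_tags, lifting) linorder_neq_iff mem_Collect_eq not_less_iff_gr_or_eq)
  then have Z: "card Z \<le> 1" using fin card_le_Suc0_iff_eq[of Z] by (simp add: Z_def)
  have "S = (U \<union> V) \<union> Z" by (auto simp: U_def V_def Z_def)
  then have "card S = card ((U \<union> V) \<union> Z)" by (rule arg_cong)
  also have "\<dots> = card U + card V + card Z"
    by (subst card_Un_disjoint, use fin in \<open>auto simp: U_def V_def Z_def\<close>)+
  finally have "card S mod 2 = card Z mod 2" unfolding UV by presburger
  then show ?thesis using Z unfolding Z_def by simp
qed

section \<open>Labelled involutions and symmetric tables\<close>

text \<open>\<open>label_mono\<close> is the extension, by oddness and transitivity, of the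
  condition between neighbours \<open>i\<close> and \<open>i + 1\<close> with
  \<open>0 <= i < n\<close>; \<open>labellings_iff\<close> proves the equivalence.\<close>

locale labelled_involution =
  fixes n k :: nat and p g :: "int \<Rightarrow> int"
  assumes involution: "odd_involution n p"
    and label_odd: "i \<in> {- int n..int n} \<Longrightarrow> g (- i) = - g i"
    and label_bound: "i \<in> {- int n..int n} \<Longrightarrow> \<bar>g i\<bar> \<le> int k"
    and label_mono: "i \<in> {- int n..int n} \<Longrightarrow> j \<in> {- int n..int n} \<Longrightarrow> i < j \<Longrightarrow> g i < g j \<or> g i = g j \<and> p i < p j"

definition cell :: "nat \<Rightarrow> (int \<Rightarrow> int) \<Rightarrow> (int \<Rightarrow> int) \<Rightarrow> int \<Rightarrow> int \<Rightarrow> int set" where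
  "cell n p g a b = {i \<in> {- int n..int n}. g i = a \<and> g (p i) = b}"

definition table_of :: "nat \<Rightarrow> (int \<Rightarrow> int) \<Rightarrow> (int \<Rightarrow> int) \<Rightarrow> int \<Rightarrow> int \<Rightarrow> nat" where
  "table_of n p g a b = card (cell n p g a b)"

definition table_size :: "nat \<Rightarrow> (int \<Rightarrow> int \<Rightarrow> nat) \<Rightarrow> nat" where
  "table_size k M = (\<Sum>a\<in>{- int k..int k}. \<Sum>b\<in>{- int k..int k}. M a b)"

text \<open>A fixed point \<open>p i = i\<close> labelled \<open>a\<close> lies in the cell \<open>(a, a)\<close>, which consists of such points only. On the
  cell \<open>(a, -a)\<close> with \<open>a \<noteq> 0\<close> the map \<open>i \<mapsto> - p i\<close> is a decreasing involution, so it has at most one fixed point,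
  and this is the only way to have \<open>p i = - i\<close>. The cell \<open>(0, 0)\<close> contains the dummy position \<open>0\<close> and is symmetric
  about it.\<close>

definition table_fix :: "nat \<Rightarrow> (int \<Rightarrow> int \<Rightarrow> nat) \<Rightarrow> nat" where
  "table_fix k M = M 0 0 div 2 + (\<Sum>a\<in>{1..int k}. M a a + M a (- a) mod 2)"

definition tables :: "nat \<Rightarrow> (int \<Rightarrow> int \<Rightarrow> nat) set" where
  "tables k = {M. (\<forall>a b. M a b \<noteq> 0 \<longrightarrow> \<bar>a\<bar> \<le> int k \<and> \<bar>b\<bar> \<le> int k) \<and> (\<forall>a b. M a b = M b a)
     \<and> (\<forall>a b. M (- a) (- b) = M a b) \<and> odd (M 0 0)}"

text \<open>The table is unfolded into a set with \<open>M a b\<close> elements over \<open>(a, b)\<close>. Its lexicographic order recovers the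
  positions \<open>-n, \<dots>, n\<close>, and exchanging \<open>a\<close> and \<open>b\<close> recovers the involution.\<close>

definition boxes :: "nat \<Rightarrow> (int \<Rightarrow> int \<Rightarrow> nat) \<Rightarrow> (int \<times> int \<times> int) set" where
  "boxes k M = (SIGMA a:{- int k..int k}. SIGMA b:{- int k..int k}. {0..<int (M a b)})"

lemma finite_boxes: "finite (boxes k M)"
  unfolding boxes_def by (intro finite_SigmaI) auto

lemma card_boxes: "card (boxes k M) = table_size k M"
  unfolding boxes_def table_size_def by (subst card_SigmaI; simp)+

lemma finite_cell: "finite (cell n p g a b)"
  unfolding cell_def by (rule finite_subset[of _ "{- int n..int n}"]) auto

context labelled_involution
begin

abbreviation "I \<equiv> {- int n..int n}"

lemma p_I: "i \<in> I \<Longrightarrow> p i \<in> I" and p_p: "i \<in> I \<Longrightarrow> p (p i) = i" and p_odd: "i \<in> I \<Longrightarrow> p (- i) = - p i"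
  using involution unfolding odd_involution_def by auto

lemma p_less: "i \<in> I \<Longrightarrow> j \<in> I \<Longrightarrow> g i = g j \<Longrightarrow> p i < p j \<longleftrightarrow> i < j"
  using label_mono[of i j] label_mono[of j i] by (metis less_irrefl linorder_neq_iff less_asym)

lemma label_0: "g 0 = 0"
  using label_odd[of 0] by simp

lemma label_sgn: "i \<in> I \<Longrightarrow> g i > 0 \<Longrightarrow> i > 0"
  using label_mono[of i 0] label_0 by (cases i "0::int" rule: linorder_cases) auto

lemma label_nonneg: "i \<in> I \<Longrightarrow> i > 0 \<Longrightarrow> g i \<ge> 0"
  using label_mono[of 0 i] label_0 by auto

lemma bij_swap_cell: "bij_betw p (cell n p g a b) (cell n p g b a)"
  by (rule bij_betw_byWitness[of _ p]) (use p_I p_p in \<open>auto simp: cell_def\<close>)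

lemma bij_minus_cell: "bij_betw uminus (cell n p g a b) (cell n p g (- a) (- b))"
proof -
  have "- i \<in> cell n p g (- a) (- b)" if "i \<in> cell n p g a b" for i a b
  proof -
    have "i \<in> I" "g i = a" "g (p i) = b" using that by (simp_all add: cell_def)
    then show ?thesis using label_odd[of i] label_odd[OF p_I, of i] p_odd[of i] by (simp add: cell_def)
  qed
  from this[of _ a b] this[of _ "- a" "- b"] show ?thesis
    by (intro bij_betw_byWitness[of _ uminus]) auto
qed

lemma card_origin_cell:
  "table_of n p g 0 0 = 2 * card {i \<in> {1..int n}. g i = 0 \<and> g (p i) = 0} + 1"
proof -
  let ?C = "{i \<in> {1..int n}. g i = 0 \<and> g (p i) = 0}"
  have p0: "p 0 = 0" using p_odd[of 0] by simp
  have "cell n p g 0 0 = insert 0 (?C \<union> uminus ` ?C)"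
  proof (intro equalityI subsetI)
    fix i assume i: "i \<in> cell n p g 0 0"
    then have "- i \<in> cell n p g 0 0" using bij_minus_cell[of 0 0] by (auto simp: bij_betw_def)
    with i show "i \<in> insert 0 (?C \<union> uminus ` ?C)"
      by (cases i "0::int" rule: linorder_cases) (auto simp: cell_def intro: image_eqI[of _ _ "- i"])
  next
    fix i assume "i \<in> insert 0 (?C \<union> uminus ` ?C)"
    then consider "i = 0" | "i \<in> ?C" | "- i \<in> ?C" by auto
    then show "i \<in> cell n p g 0 0"
    proof cases
      case 3
      then have "- i \<in> cell n p g 0 0" by (auto simp: cell_def)
      then show ?thesis using bij_minus_cell[of 0 0] by (force simp: bij_betw_def)
    qed (auto simp: cell_def p0 label_0)
  qed
  moreover have fin: "finite ?C" by (rule finite_subset[of _ "{1..int n}"]) auto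
  have "card (?C \<union> uminus ` ?C) = card ?C + card (uminus ` ?C)"
    by (rule card_Un_disjoint) (use fin in auto)
  moreover have "card (uminus ` ?C) = card ?C" by (rule card_image) simp
  moreover have "card (insert 0 (?C \<union> uminus ` ?C)) = Suc (card (?C \<union> uminus ` ?C))"
    by (rule card_insert_disjoint) (use fin in auto)
  ultimately show ?thesis unfolding table_of_def by simp
qed

lemma table_of_in_tables: "table_of n p g \<in> tables k"
proof -
  have "\<bar>a\<bar> \<le> int k \<and> \<bar>b\<bar> \<le> int k" if nz: "table_of n p g a b \<noteq> 0" for a b
  proof -
    obtain i where "i \<in> cell n p g a b" using nz unfolding table_of_def by (metis card.empty ex_in_conv)
    then show ?thesis using label_bound p_I unfolding cell_def by blast
  qed
  moreover have "table_of n p g a b = table_of n p g b a" for a b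
    unfolding table_of_def by (rule bij_betw_same_card[OF bij_swap_cell])
  moreover have "table_of n p g (- a) (- b) = table_of n p g a b" for a b
    unfolding table_of_def by (rule bij_betw_same_card[OF bij_minus_cell, symmetric])
  moreover have "odd (table_of n p g 0 0)" unfolding card_origin_cell by simp
  ultimately show ?thesis unfolding tables_def by blast
qed

lemma table_size_table_of: "table_size k (table_of n p g) = 2 * n + 1"
proof -
  let ?K = "{- int k..int k}"
  have "I = (\<Union>(a, b)\<in>?K \<times> ?K. cell n p g a b)"
    using label_bound p_I by (fastforce simp: cell_def abs_le_iff)
  then have "card I = card (\<Union>(a, b)\<in>?K \<times> ?K. cell n p g a b)" by (rule arg_cong)
  also have "\<dots> = (\<Sum>(a, b)\<in>?K \<times> ?K. table_of n p g a b)"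
    unfolding table_of_def case_prod_unfold
  proof (rule card_UN_disjoint)
    show "\<forall>x\<in>?K \<times> ?K. \<forall>y\<in>?K \<times> ?K. x \<noteq> y \<longrightarrow> cell n p g (fst x) (snd x) \<inter> cell n p g (fst y) (snd y) = {}"
      by (auto simp: cell_def)
  qed (auto simp: finite_cell)
  finally show ?thesis unfolding table_size_def sum.cartesian_product by simp
qed

text \<open>If \<open>i < p i\<close> carried equal labels, \<open>p\<close> would increase on this
  pair and give \<open>p i < p (p i) = i\<close>; likewise for \<open>p i < i\<close>.\<close>

lemma fixed_iff: "i \<in> I \<Longrightarrow> p i = i \<longleftrightarrow> g (p i) = g i"
  using p_less[of i "p i"] p_less[of "p i" i] p_I[of i] p_p[of i] by (metis less_asym linorder_neq_iff)

lemma table_fix_table_of: "table_fix k (table_of n p g) = card {i \<in> {1..int n}. \<bar>p i\<bar> = i}"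
proof -
  let ?F = "\<lambda>Q. {i \<in> {1..int n}. Q i}"
  have fin: "finite (?F Q)" for Q by (rule finite_subset[of _ "{1..int n}"]) auto
  have origin: "card (?F (\<lambda>i. g i = 0 \<and> p i = i)) = table_of n p g 0 0 div 2"
  proof -
    have "?F (\<lambda>i. g i = 0 \<and> p i = i) = {i \<in> {1..int n}. g i = 0 \<and> g (p i) = 0}"
      using fixed_iff by auto
    then show ?thesis unfolding card_origin_cell by simp
  qed
  have pos: "card (?F (\<lambda>i. g i = a \<and> p i = i)) = table_of n p g a a" if "a \<in> {1..int k}" for a
  proof -
    \<comment> \<open>A positive label forces a positive position, so the restriction to
      \<open>{1..int n}\<close> cuts nothing off the cell.\<close>
    have "?F (\<lambda>i. g i = a \<and> p i = i) = cell n p g a a"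
      unfolding cell_def using fixed_iff label_sgn that by fastforce
    then show ?thesis unfolding table_of_def by simp
  qed
  have neg: "card (?F (\<lambda>i. g i = a \<and> p i = - i)) = table_of n p g a (- a) mod 2" if a: "a \<in> {1..int k}" for a
  proof -
    let ?C = "cell n p g a (- a)"
    have C: "i \<in> I" "g i = a" "g (p i) = - a" if "i \<in> ?C" for i using that by (auto simp: cell_def)
    have "card {i \<in> ?C. - p i = i} = card ?C mod 2"
    proof (rule decreasing_involution_fixpoints[OF finite_cell])
      fix i assume i: "i \<in> ?C"
      then show "- p (- p i) = i" using C[OF i] p_I p_p p_odd by simp
      show "- p i \<in> ?C" using C[OF i] p_I[OF C(1)[OF i]] p_p[of i] p_odd[of "p i"] label_odd[of i] label_odd[of "p i"]
        by (auto simp: cell_def)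
    next
      fix i j assume "i \<in> ?C" "j \<in> ?C" "i < j"
      then show "- p j < - p i" using p_less[of i j] C by simp
    qed
    moreover have "{i \<in> ?C. - p i = i} = ?F (\<lambda>i. g i = a \<and> p i = - i)"
    proof (intro equalityI subsetI)
      fix i assume i: "i \<in> {i \<in> ?C. - p i = i}"
      then have "i > 0" using label_sgn[of i] C[of i] a by auto
      with i show "i \<in> ?F (\<lambda>i. g i = a \<and> p i = - i)" by (auto simp: cell_def)
    next
      fix i assume i: "i \<in> ?F (\<lambda>i. g i = a \<and> p i = - i)"
      then show "i \<in> {i \<in> ?C. - p i = i}" using label_odd[of i] by (auto simp: cell_def)
    qed
    ultimately show ?thesis unfolding table_of_def by simp
  qed
  \<comment> \<open>The positions \<open>0 < i\<close> would share the label \<open>0\<close>, so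
    \<open>0 = p 0 < p i\<close>.\<close>
  have noneg: "?F (\<lambda>i. g i = 0 \<and> p i = - i) = {}"
  proof -
    have False if "i \<in> {1..int n}" "g i = 0" "p i = - i" for i
      using p_less[of 0 i] that label_0 p_odd[of 0] by auto
    then show ?thesis by auto
  qed
  have "?F (\<lambda>i. \<bar>p i\<bar> = i) = ?F (\<lambda>i. g i = 0 \<and> p i = i) \<union>
      (\<Union>a\<in>{1..int k}. ?F (\<lambda>i. g i = a \<and> p i = i) \<union> ?F (\<lambda>i. g i = a \<and> p i = - i))" (is "?L = ?R")
  proof (intro equalityI subsetI)
    fix i assume i: "i \<in> ?L"
    then have iI: "i \<in> I" and "i > 0" by auto
    then have "g i \<ge> 0" "g i \<le> int k" using label_nonneg label_bound[OF iI] by auto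
    moreover have "p i = i \<or> p i = - i" using i by auto
    ultimately show "i \<in> ?R" using i noneg by (cases "g i = 0") auto
  qed auto
  then have "card ?L = card (?F (\<lambda>i. g i = 0 \<and> p i = i)) 
     + card (\<Union>a\<in>{1..int k}. ?F (\<lambda>i. g i = a \<and> p i = i) \<union> ?F (\<lambda>i. g i = a \<and> p i = - i))"
    using fin by (subst card_Un_disjoint[symmetric]) auto
  also have "card (\<Union>a\<in>{1..int k}. ?F (\<lambda>i. g i = a \<and> p i = i) \<union> ?F (\<lambda>i. g i = a \<and> p i = - i))
    = (\<Sum>a\<in>{1..int k}. card (?F (\<lambda>i. g i = a \<and> p i = i) \<union> ?F (\<lambda>i. g i = a \<and> p i = - i)))"
    using fin by (intro card_UN_disjoint) auto
  also have "\<dots> = (\<Sum>a\<in>{1..int k}. table_of n p g a a + table_of n p g a (- a) mod 2)"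
  proof (rule sum.cong[OF refl])
    fix a assume a: "a \<in> {1..int k}"
    have "card (?F (\<lambda>i. g i = a \<and> p i = i) \<union> ?F (\<lambda>i. g i = a \<and> p i = - i)) 
      = card (?F (\<lambda>i. g i = a \<and> p i = i)) + card (?F (\<lambda>i. g i = a \<and> p i = - i))"
      using fin by (intro card_Un_disjoint) auto
    then show "card (?F (\<lambda>i. g i = a \<and> p i = i) \<union> ?F (\<lambda>i. g i = a \<and> p i = - i)) = table_of n p g a a + table_of n p g a (- a) mod 2"
      unfolding pos[OF a] neg[OF a] .
  qed
  finally show ?thesis unfolding table_fix_def origin by simp
qed

definition box_of :: "int \<Rightarrow> int \<times> int \<times> int" where
  "box_of i = (g i, g (p i), int (card {j \<in> cell n p g (g i) (g (p i)). j < i}))"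

text \<open>Among equal labels \<open>p\<close> increases, so \<open>g (p i)\<close> increases
  weakly; inside one cell the rank decides.\<close>

lemma box_of_less:
  assumes "i \<in> I" "j \<in> I" "i < j"
  shows "box_of i < box_of j"
proof (cases "g i = g j")
  case True
  then have "p i < p j" using p_less assms by blast
  then have *: "g (p i) \<le> g (p j)" using label_mono[of "p i" "p j"] p_I assms by force
  show ?thesis
  proof (cases "g (p i) = g (p j)")
    case same: True
    have "card {l \<in> cell n p g (g i) (g (p i)). l < i} < card {l \<in> cell n p g (g i) (g (p i)). l < j}"
    proof (rule psubset_card_mono)
      have "i \<in> cell n p g (g i) (g (p i))" using assms by (simp add: cell_def)
      then show "{l \<in> cell n p g (g i) (g (p i)). l < i} \<subset> {l \<in> cell n p g (g i) (g (p i)). l < j}"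
        using assms(3) by fastforce
    qed (simp add: finite_cell)
    then show ?thesis unfolding box_of_def using True same by (simp add: less_prod_def)
  qed (use True * in \<open>auto simp: box_of_def less_prod_def\<close>)
qed (use label_mono[OF assms] in \<open>auto simp: box_of_def less_prod_def\<close>)

lemma bij_box_of: "bij_betw box_of I (boxes k (table_of n p g))"
proof -
  have inj: "inj_on box_of I"
    by (rule inj_onI) (metis box_of_less less_irrefl linorder_neq_iff)
  have "box_of i \<in> boxes k (table_of n p g)" if i: "i \<in> I" for i
  proof -
    have "card {j \<in> cell n p g (g i) (g (p i)). j < i} < table_of n p g (g i) (g (p i))"
      unfolding table_of_def by (rule psubset_card_mono[OF finite_cell]) (use i in \<open>auto simp: cell_def\<close>)
    then show ?thesis unfolding boxes_def box_of_def
      using label_bound[OF i] label_bound[OF p_I[OF i]] by (simp add: abs_le_iff)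
  qed
  then have "box_of ` I \<subseteq> boxes k (table_of n p g)" by auto
  moreover have "card (box_of ` I) = card (boxes k (table_of n p g))"
    unfolding card_boxes table_size_table_of by (simp add: card_image[OF inj])
  ultimately show ?thesis using inj finite_boxes unfolding bij_betw_def by (metis card_subset_eq)
qed

text \<open>\<open>p\<close> maps a cell increasingly onto the swapped cell, so ranks inside the two
  cells agree.\<close>

lemma box_of_swap:
  assumes "i \<in> I"
  shows "box_of (p i) = (fst (snd (box_of i)), fst (box_of i), snd (snd (box_of i)))"
proof -
  have "bij_betw p {j \<in> cell n p g (g i) (g (p i)). j < i} {j \<in> cell n p g (g (p i)) (g i). j < p i}"
  proof (rule bij_betw_byWitness[of _ p])
    show "p ` {j \<in> cell n p g (g i) (g (p i)). j < i} \<subseteq> {j \<in> cell n p g (g (p i)) (g i). j < p i}"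
      using assms p_I p_p p_less by (auto simp: cell_def)
    show "p ` {j \<in> cell n p g (g (p i)) (g i). j < p i} \<subseteq> {j \<in> cell n p g (g i) (g (p i)). j < i}"
    proof (intro subsetI, elim imageE)
      fix x j assume "x = p j" "j \<in> {j \<in> cell n p g (g (p i)) (g i). j < p i}"
      then show "x \<in> {j \<in> cell n p g (g i) (g (p i)). j < i}"
        using assms p_I p_p p_less[of j "p i"] by (auto simp: cell_def)
    qed
  qed (auto simp: cell_def intro: p_p)
  then show ?thesis unfolding box_of_def using assms p_p bij_betw_same_card by fastforce
qed

end

text \<open>Both pairs enumerate the same boxes in increasing order, so their \<open>box_of\<close>
  agree. The label is the first entry of the box, and \<open>p\<close> acts by swapping the first
  two entries.\<close>

lemma labelled_involution_unique:
  assumes "labelled_involution n k p g" "labelled_involution n k p' g'" 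
    and M: "table_of n p g = table_of n p' g'" and i: "i \<in> {- int n..int n}"
  shows "p i = p' i \<and> g i = g' i"
proof -
  interpret A: labelled_involution n k p g by fact
  interpret B: labelled_involution n k p' g' by fact
  have eq: "A.box_of i = B.box_of i" if "i \<in> {- int n..int n}" for i
    using strict_mono_bij_unique[OF finite_boxes A.bij_box_of B.bij_box_of[folded M] A.box_of_less B.box_of_less that] by blast
  have "A.box_of (p i) = A.box_of (p' i)"
    using A.box_of_swap[OF i] B.box_of_swap[OF i] eq[OF i] eq[OF B.p_I[OF i]] by simp
  then have "p i = p' i"
    using A.bij_box_of A.p_I[OF i] B.p_I[OF i] by (auto simp: bij_betw_def inj_on_def)
  moreover have "g i = g' i" using eq[OF i] by (simp add: A.box_of_def B.box_of_def)
  ultimately show ?thesis by simp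
qed

lemma labelled_involution_exists:
  assumes M: "M \<in> tables k" and size: "table_size k M = 2 * n + 1"
  obtains p g where "labelled_involution n k p g" "table_of n p g = M"
proof -
  define S where "S = boxes k M"
  let ?I = "{- int n..int n}"
  have fin: "finite S" and cardS: "card S = 2 * n + 1" unfolding S_def by (simp_all add: finite_boxes card_boxes size)
  have supp: "M a b \<noteq> 0 \<Longrightarrow> \<bar>a\<bar> \<le> int k \<and> \<bar>b\<bar> \<le> int k" and sym: "M a b = M b a" and csym: "M (- a) (- b) = M a b" for a b
    using M unfolding tables_def by blast+
  have inS: "(a, b, c) \<in> S \<longleftrightarrow> 0 \<le> c \<and> c < int (M a b)" for a b c
    using supp[of a b] unfolding S_def boxes_def by auto
  \<comment> \<open>Ranks run from \<open>0\<close> to \<open>2n\<close>; subtracting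
    \<open>n\<close> centers them at the position \<open>0\<close>.\<close>
  define r where "r x = int (rank S x) - int n" for x
  have r_bij: "bij_betw r S ?I"
  proof -
    have "bij_betw (\<lambda>m. int m - int n) {..<2 * n + 1} ?I"
      by (rule bij_betw_byWitness[of _ "\<lambda>i. nat (i + int n)"]) auto
    then show ?thesis using bij_betw_trans[OF bij_betw_rank[OF fin]] unfolding cardS r_def comp_def by blast
  qed
  have r_less: "r x < r y" if "x \<in> S" "x < y" for x y
    using rank_less[OF fin that] by (simp add: r_def)
  define \<psi> where "\<psi> = inv_into S r"
  have \<psi>S: "\<psi> i \<in> S" and r\<psi>: "r (\<psi> i) = i" if "i \<in> ?I" for i
    using that r_bij unfolding \<psi>_def bij_betw_def by (auto intro: inv_into_into f_inv_into_f)
  have \<psi>r: "\<psi> (r x) = x" and rI: "r x \<in> ?I" if "x \<in> S" for x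
    using that r_bij unfolding \<psi>_def bij_betw_def by auto
  have \<psi>_less: "\<psi> i < \<psi> j" if "i \<in> ?I" "j \<in> ?I" "i < j" for i j
    using r_less[of "\<psi> j" "\<psi> i"] \<psi>S r\<psi> that by (metis less_asym linorder_neq_iff)
  \<comment> \<open>The third entry is reversed too: this makes \<open>neg\<close> strictly
    decreasing, so it exchanges ranks from below and from above and becomes negation of
    positions.\<close>
  define neg where "neg = (\<lambda>(a, b, c). (- a, - b, int (M a b) - 1 - c))"
  define swap where "swap = (\<lambda>(a :: int, b :: int, c :: int). (b, a, c))"
  have negS: "neg x \<in> S" "neg (neg x) = x" if "x \<in> S" for x
    using that by (cases x; auto simp: neg_def inS csym)+
  have swapS: "swap x \<in> S" "swap (swap x) = x" "swap (neg x) = neg (swap x)" if "x \<in> S" for x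
    using that sym by (cases x; auto simp: swap_def neg_def inS)+
  have neg_less: "neg y < neg x" if "x < y" for x y
    using that by (cases x; cases y) (auto simp: neg_def less_prod_def)
  have r_neg: "r (neg x) = - r x" if x: "x \<in> S" for x
  proof -
    have "bij_betw neg {y \<in> S. y < neg x} {y \<in> S. x < y}"
      by (rule bij_betw_byWitness[of _ neg])
        (use negS neg_less x in \<open>auto, (metis neg_less negS)+\<close>)
    then have "rank S (neg x) = card {y \<in> S. x < y}" unfolding rank_def by (rule bij_betw_same_card)
    moreover have "S = insert x ({y \<in> S. y < x} \<union> {y \<in> S. x < y})" using x by auto
    then have "card S = card (insert x ({y \<in> S. y < x} \<union> {y \<in> S. x < y}))" by (rule arg_cong)
    then have "2 * n + 1 = Suc (rank S x + card {y \<in> S. x < y})"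
      unfolding cardS rank_def using fin by (subst (asm) card_insert_disjoint, simp, simp, subst (asm) card_Un_disjoint) auto
    ultimately show ?thesis unfolding r_def by simp
  qed
  have \<psi>_minus: "\<psi> (- i) = neg (\<psi> i)" if "i \<in> ?I" for i
    using r_neg[OF \<psi>S[OF that]] \<psi>r[OF negS(1)[OF \<psi>S[OF that]]] r\<psi>[OF that] by simp
  define p where "p i = r (swap (\<psi> i))" for i
  define g where "g i = fst (\<psi> i)" for i
  have \<psi>p: "\<psi> (p i) = swap (\<psi> i)" if "i \<in> ?I" for i
    unfolding p_def using \<psi>r swapS(1) \<psi>S that by blast
  have "odd_involution n p"
    unfolding odd_involution_def
  proof (intro ballI conjI)
    fix i assume i: "i \<in> ?I"
    show "p i \<in> ?I" unfolding p_def using i rI swapS(1) \<psi>S by blast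
    show "p (p i) = i" unfolding p_def[of "p i"] \<psi>p[OF i] using swapS(2) \<psi>S r\<psi> i by simp
    show "p (- i) = - p i" unfolding p_def \<psi>_minus[OF i] using swapS \<psi>S[OF i] r_neg by simp
  qed
  moreover have "g i < g j \<or> g i = g j \<and> p i < p j" if ij: "i \<in> ?I" "j \<in> ?I" "i < j" for i j
  proof -
    have less: "\<psi> i < \<psi> j" by (rule \<psi>_less[OF ij])
    \<comment> \<open>Among boxes with the same first entry, exchanging the first two entries
      preserves the lexicographic order.\<close>
    have "swap (\<psi> i) < swap (\<psi> j)" if "g i = g j"
      using less that unfolding g_def swap_def by (cases "\<psi> i"; cases "\<psi> j") (auto simp: less_prod_def)
    then have "p i < p j" if "g i = g j"
      unfolding p_def using r_less swapS(1) \<psi>S ij(1) that by blast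
    moreover have "g i \<le> g j" using less unfolding g_def by (cases "\<psi> i"; cases "\<psi> j") (auto simp: less_prod_def)
    ultimately show ?thesis by auto
  qed
  moreover have "g (- i) = - g i" if "i \<in> ?I" for i
    unfolding g_def \<psi>_minus[OF that] by (simp add: neg_def case_prod_unfold)
  moreover have "\<bar>g i\<bar> \<le> int k" if "i \<in> ?I" for i
    using \<psi>S[OF that] unfolding g_def S_def boxes_def by auto
  ultimately have "labelled_involution n k p g" by unfold_locales auto
  moreover have "table_of n p g = M"
  proof (intro ext)
    fix a b
    have "bij_betw r {x \<in> S. fst x = a \<and> fst (snd x) = b} (cell n p g a b)"
    proof (rule bij_betw_byWitness[of _ \<psi>])
      have "g (p i) = fst (snd (\<psi> i))" if "i \<in> ?I" for i
        unfolding g_def \<psi>p[OF that] by (simp add: swap_def case_prod_unfold)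
      then have c: "cell n p g a b = {i \<in> ?I. fst (\<psi> i) = a \<and> fst (snd (\<psi> i)) = b}"
        unfolding cell_def by (auto simp: g_def)
      show "r ` {x \<in> S. fst x = a \<and> fst (snd x) = b} \<subseteq> cell n p g a b"
        unfolding c using rI \<psi>r by auto
      show "\<psi> ` cell n p g a b \<subseteq> {x \<in> S. fst x = a \<and> fst (snd x) = b}"
        unfolding c using \<psi>S by auto
    qed (auto simp: \<psi>r r\<psi> cell_def)
    then have "table_of n p g a b = card {x \<in> S. fst x = a \<and> fst (snd x) = b}"
      unfolding table_of_def by (rule bij_betw_same_card[symmetric])
    also have "{x \<in> S. fst x = a \<and> fst (snd x) = b} = (\<lambda>c. (a, b, c)) ` {0..<int (M a b)}"
      by (auto simp: inS)
    also have "card \<dots> = M a b" by (subst card_image) (auto simp: inj_on_def)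
    finally show "table_of n p g a b = M a b" .
  qed
  ultimately show ?thesis by (rule that)
qed

text \<open>As \<open>act w\<close> is injective, a non-descent is a strict ascent, so every step is
  strict in the order \<open>Q\<close>. Oddness mirrors the steps to negative positions, and
  transitivity reaches all pairs. The step from \<open>0\<close> to \<open>1\<close> is the type B
  descent condition at \<open>0\<close>.\<close>

lemma labellings_iff:
  assumes w: "w \<in> involutionsB n"
  shows "l \<in> labellings w (int k) \<longleftrightarrow> length l = n \<and> labelled_involution n k (act w) (act l)"
proof -
  have len: "length w = n" and odd: "odd_involution n (act w)" using w involutionsB_iff by auto
  have inv: "act w (act w i) = i" if "i \<in> {- int n..int n}" for i
    using odd that unfolding odd_involution_def by auto
  have inj: "act w i \<noteq> act w j" if "i \<in> {- int n..int n}" "j \<in> {- int n..int n}" "i \<noteq> j" for i j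
    using inv[of i] inv[of j] that by metis
  show ?thesis
  proof
    assume l: "l \<in> labellings w (int k)"
    then have "length l = n" and top: "act l (int n) \<le> int k"
      and step: "i < n \<Longrightarrow> act l (int i) + of_bool (act w (int i) > act w (int i + 1)) \<le> act l (int i + 1)" for i
      unfolding labellings_def bounded_chains_def len by auto
    define Q where "Q i j \<longleftrightarrow> act l i < act l j \<or> act l i = act l j \<and> act w i < act w j" for i j
    have Q_trans: "Q i j \<Longrightarrow> Q j m \<Longrightarrow> Q i m" for i j m unfolding Q_def by auto
    have Q_pos: "Q (int i) (int i + 1)" if "i < n" for i
      using step[OF that] inj[of "int i" "int i + 1"] that unfolding Q_def
      by (cases "act w (int i) > act w (int i + 1)") auto
    have Q_step: "Q i (i + 1)" if "- int n \<le> i" "i < int n" for i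
    proof (cases "i \<ge> 0")
      case True
      then show ?thesis using Q_pos[of "nat i"] that by simp
    next
      case False
      then have "Q (- i - 1) (- i)" using Q_pos[of "nat (- i - 1)"] that by simp
      moreover have "act v (- i - 1) = - act v (i + 1)" for v using act_minus[of v "i + 1"] by simp
      ultimately show ?thesis unfolding Q_def by (simp add: act_minus) linarith
    qed
    have mono: "Q i j" if "i < j" "- int n \<le> i" "j \<le> int n" for i j
      using that
    proof (induction j rule: int_gr_induct)
      case base then show ?case using Q_step by simp
    next
      case (step j) then show ?case using Q_trans Q_step[of j] by auto
    qed
    have "labelled_involution n k (act w) (act l)"
    proof
      fix i assume i: "i \<in> {- int n..int n}"
      have le: "act l i \<le> int k" if "i \<in> {- int n..int n}" for i
        using mono[of i "int n"] top that unfolding Q_def by (cases "i = int n") auto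
      show "\<bar>act l i\<bar> \<le> int k" using le[OF i] le[of "- i"] i by (auto simp: act_minus)
    qed (use odd mono in \<open>auto simp: act_minus Q_def\<close>)
    with \<open>length l = n\<close> show "length l = n \<and> labelled_involution n k (act w) (act l)" by simp
  next
    assume l: "length l = n \<and> labelled_involution n k (act w) (act l)"
    then interpret labelled_involution n k "act w" "act l" by simp
    have "act l (int i) + of_bool (act w (int i) > act w (int i + 1)) \<le> act l (int i + 1)" if "i < n" for i
      using label_mono[of "int i" "int i + 1"] that by auto
    moreover have "act l (int n) \<le> int k" using label_bound[of "int n"] by simp
    ultimately show "l \<in> labellings w (int k)" using l unfolding labellings_def bounded_chains_def len by simp
  qed
qed

definition labelled_words :: "nat \<Rightarrow> nat \<Rightarrow> nat \<Rightarrow> (int list \<times> int list) set" where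
  "labelled_words n f k = (SIGMA w:{w \<in> involutionsB n. fixB w = f}. labellings w (int k))"

definition fix_tables :: "nat \<Rightarrow> nat \<Rightarrow> nat \<Rightarrow> (int \<Rightarrow> int \<Rightarrow> nat) set" where
  "fix_tables n f k = {M \<in> tables k. table_size k M = 2 * n + 1 \<and> table_fix k M = f}"

lemma bij_betw_tables:
  "bij_betw (\<lambda>(w, l). table_of n (act w) (act l)) (labelled_words n f k) (fix_tables n f k)"
proof -
  have mem: "(w, l) \<in> labelled_words n f k \<longleftrightarrow> length w = n \<and> length l = n \<and> fixB w = f \<and> labelled_involution n k (act w) (act l)" for w l
    unfolding labelled_words_def using labellings_iff involutionsB_iff labelled_involution.involution by auto
  have fixB: "fixB w = table_fix k (table_of n (act w) (act l))" 
    if "length w = n" "labelled_involution n k (act w) (act l)" for w l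
    using labelled_involution.table_fix_table_of[OF that(2)] that(1) by (simp add: fixB_def)
  show ?thesis unfolding bij_betw_def
  proof (intro conjI equalityI subsetI)
    show "inj_on (\<lambda>(w, l). table_of n (act w) (act l)) (labelled_words n f k)"
    proof (rule inj_onI, clarify)
      fix w l w' l' assume A: "(w, l) \<in> labelled_words n f k" "(w', l') \<in> labelled_words n f k"
        and eq: "table_of n (act w) (act l) = table_of n (act w') (act l')"
      then have "act w i = act w' i \<and> act l i = act l' i" if "i \<in> {1..int n}" for i
        using labelled_involution_unique[of n k "act w" "act l" "act w'" "act l'" i] that unfolding mem by auto
      then show "w = w' \<and> l = l'" using word_eqI A unfolding mem by blast
    qed
  next
    fix M assume "M \<in> (\<lambda>(w, l). table_of n (act w) (act l)) ` labelled_words n f k"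
    then obtain w l where wl: "(w, l) \<in> labelled_words n f k" "M = table_of n (act w) (act l)" by auto
    then interpret labelled_involution n k "act w" "act l" unfolding mem by simp
    show "M \<in> fix_tables n f k"
      using wl table_of_in_tables table_size_table_of fixB[of w l] unfolding mem fix_tables_def by simp
  next
    fix M assume M: "M \<in> fix_tables n f k"
    then obtain p g where pg: "labelled_involution n k p g" "table_of n p g = M"
      using labelled_involution_exists[of M k n] unfolding fix_tables_def by blast
    then interpret labelled_involution n k p g by simp
    let ?w = "map p [1..int n]" and ?l = "map g [1..int n]"
    have w: "act ?w i = p i" and l: "act ?l i = g i" if "i \<in> I" for i
      using act_map[of n p i] act_map[of n g i] p_odd label_odd that by simp_all
    have "odd_involution n (act ?w)"
      unfolding odd_involution_def using w p_I p_p act_minus by simp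
    then have li: "labelled_involution n k (act ?w) (act ?l)"
      by unfold_locales (simp_all only: w l act_minus label_bound label_mono)
    have "cell n (act ?w) (act ?l) a b = cell n p g a b" for a b
      unfolding cell_def using w l p_I by (metis (no_types, lifting))
    then have T: "table_of n (act ?w) (act ?l) = M" unfolding pg(2)[symmetric] table_of_def by simp
    moreover have "fixB ?w = f" using fixB[of ?w ?l] li M unfolding T fix_tables_def by simp
    ultimately have "(?w, ?l) \<in> labelled_words n f k" using li unfolding mem by simp
    then show "M \<in> (\<lambda>(w, l). table_of n (act w) (act l)) ` labelled_words n f k"
      using T by (intro image_eqI[of _ _ "(?w, ?l)"]) simp_all
  qed
qed

lemma F_eq: "F j f = (\<Sum>w\<in>{w \<in> involutionsB (2 * j + f). fixB w = f}. monom 1 (desB w))"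
proof -
  have "{w \<in> involutionsB (2 * j + f). cyc2 w = j \<and> fixB w = f} = {w \<in> involutionsB (2 * j + f). fixB w = f}"
    using two_cyc2_plus_fixB[of _ "2 * j + f"] by fastforce
  then show ?thesis unfolding F_def by simp
qed

lemma F_gf:
  "fps_of_poly (F j f) = (1 - fps_X) ^ (2 * j + f + 1) * Abs_fps (\<lambda>k. of_nat (card (fix_tables (2 * j + f) f k)))"
proof -
  let ?n = "2 * j + f"
  let ?W = "{w \<in> involutionsB ?n. fixB w = f}"
  have fin: "finite ?W" using finite_involutionsB by simp
  have "card (fix_tables ?n f k) = card (labelled_words ?n f k)" for k
    by (rule bij_betw_same_card[OF bij_betw_tables, symmetric])
  also have "card (labelled_words ?n f k) = (\<Sum>w\<in>?W. card (labellings w (int k)))" for k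
    unfolding labelled_words_def using fin by (intro card_SigmaI) (auto simp: labellings_def finite_bounded_chains)
  finally have *: "card (fix_tables ?n f k) = (\<Sum>w\<in>?W. card (labellings w (int k)))" for k .
  have "Abs_fps (\<lambda>k. of_nat (card (fix_tables ?n f k))) = (\<Sum>w\<in>?W. Abs_fps (\<lambda>k. of_nat (card (labellings w (int k)))) :: rat fps)"
    by (rule fps_ext) (simp add: * fps_sum_nth)
  then have "(1 - fps_X) ^ (?n + 1) * Abs_fps (\<lambda>k. of_nat (card (fix_tables ?n f k)))
    = (\<Sum>w\<in>?W. (1 - fps_X) ^ (?n + 1) * Abs_fps (\<lambda>k. of_nat (card (labellings w (int k)))) :: rat fps)"
    by (simp only: sum_distrib_left)
  also have "\<dots> = (\<Sum>w\<in>?W. fps_X ^ desB w)"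
  proof (rule sum.cong[OF refl])
    fix w assume "w \<in> ?W"
    then have "length w = ?n" by (simp add: involutionsB_iff)
    with labellings_gf[of w]
    show "(1 - fps_X) ^ (?n + 1) * Abs_fps (\<lambda>k. of_nat (card (labellings w (int k)))) = (fps_X ^ desB w :: rat fps)"
      by simp
  qed
  also have "\<dots> = fps_of_poly (F j f)"
    unfolding F_eq fps_of_poly_sum by (simp add: fps_of_poly_monom)
  finally show ?thesis ..
qed

section \<open>Splitting off the diagonals of a table\<close>

text \<open>\<open>v a\<close> for \<open>a \<ge> 0\<close> counts the fixed points \<open>p i = i > 0\<close> labelled \<open>a\<close>, and \<open>v (- a)\<close> for \<open>a > 0\<close> the fixed
  points \<open>p i = - i\<close>, \<open>i > 0\<close>, labelled \<open>a\<close>.\<close>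

definition diagonals :: "nat \<Rightarrow> nat \<Rightarrow> (int \<Rightarrow> nat) set" where
  "diagonals k f = {v. (\<forall>a. v a \<noteq> 0 \<longrightarrow> \<bar>a\<bar> \<le> int k) \<and> (\<forall>a<0. v a \<le> 1) \<and> (\<Sum>a\<in>{- int k..int k}. v a) = f}"

lemma sum_symmetric_interval:
  "(\<Sum>a\<in>{- int k..int k}. v a) = v 0 + (\<Sum>a\<in>{1..int k}. v a + v (- a))" for v :: "int \<Rightarrow> nat"
proof -
  have "{- int k..int k} = insert 0 ({1..int k} \<union> {- int k..-1})" by auto
  then have "(\<Sum>a\<in>{- int k..int k}. v a) = (\<Sum>a\<in>insert 0 ({1..int k} \<union> {- int k..-1}). v a)" by simp
  also have "\<dots> = v 0 + ((\<Sum>a\<in>{1..int k}. v a) + (\<Sum>a\<in>{- int k..-1}. v a))"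
    by (subst sum.insert, simp, simp, subst sum.union_disjoint) auto
  also have "(\<Sum>a\<in>{- int k..-1}. v a) = (\<Sum>a\<in>{1..int k}. v (- a))"
    by (rule sum.reindex_bij_witness[of _ uminus uminus]) auto
  finally show ?thesis by (simp add: sum.distrib)
qed

lemma diagonals_0: "diagonals k 0 = {\<lambda>_. 0}"
proof -
  have "v = (\<lambda>_. 0)" if "v \<in> diagonals k 0" for v
  proof
    fix a
    have "(\<Sum>a\<in>{- int k..int k}. v a) = 0" "v a \<noteq> 0 \<longrightarrow> \<bar>a\<bar> \<le> int k" using that unfolding diagonals_def by auto
    then show "v a = 0" by (cases "v a = 0") (auto simp: abs_le_iff)
  qed
  then show ?thesis unfolding diagonals_def by auto
qed

lemma diagonals_origin: "diagonals 0 f = {(\<lambda>_. 0)(0 := f)}"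
  unfolding diagonals_def by (auto simp: fun_eq_iff split: if_splits)

lemma sum_diagonals_Suc:
  "(\<Sum>a\<in>{- int (Suc k)..int (Suc k)}. v a) = v (int (Suc k)) + v (- int (Suc k)) + (\<Sum>a\<in>{- int k..int k}. v a)" for v :: "int \<Rightarrow> nat"
proof -
  have "{1..int (Suc k)} = insert (int (Suc k)) {1..int k}" by auto
  then have "(\<Sum>a\<in>{1..int (Suc k)}. v a + v (- a)) = v (int (Suc k)) + v (- int (Suc k)) + (\<Sum>a\<in>{1..int k}. v a + v (- a))"
    by simp
  then show ?thesis unfolding sum_symmetric_interval by simp
qed

lemma diagonals_vanish: "v \<in> diagonals k f \<Longrightarrow> \<bar>a\<bar> > int k \<Longrightarrow> v a = 0"
  unfolding diagonals_def by force

text \<open>If \<open>v (k + 1) > 0\<close>, one such point is removed; otherwise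
  \<open>v (- k - 1)\<close> is \<open>0\<close> or \<open>1\<close>. These are the three terms of
  the Delannoy recurrence.\<close>

lemma diagonals_Suc:
  "diagonals (Suc k) (Suc f) = (\<lambda>v. v(int (Suc k) := Suc (v (int (Suc k))))) ` diagonals (Suc k) f
     \<union> (diagonals k (Suc f) \<union> (\<lambda>v. v(- int (Suc k) := 1)) ` diagonals k f)" (is "?L = ?A \<union> (?B \<union> ?C)")
proof (intro equalityI subsetI)
  let ?k = "int (Suc k)"
  fix v assume v: "v \<in> ?L"
  then have supp: "v a \<noteq> 0 \<Longrightarrow> \<bar>a\<bar> \<le> ?k" and neg: "a < 0 \<Longrightarrow> v a \<le> 1"
    and sum: "v ?k + v (- ?k) + (\<Sum>a\<in>{- int k..int k}. v a) = Suc f" for a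
    unfolding diagonals_def sum_diagonals_Suc by auto
  have small: "\<bar>a\<bar> \<le> int k" if "v a \<noteq> 0" "a \<noteq> ?k" "a \<noteq> - ?k" for a
    using supp[OF that(1)] that by auto
  consider m where "v ?k = Suc m" | "v ?k = 0" "v (- ?k) = 0" | "v ?k = 0" "v (- ?k) = 1"
    using neg[of "- ?k"] by (cases "v ?k"; cases "v (- ?k)") auto
  then show "v \<in> ?A \<union> (?B \<union> ?C)"
  proof cases
    case (1 m)
    let ?u = "v(?k := m)"
    have "(\<Sum>a\<in>{- int k..int k}. ?u a) = (\<Sum>a\<in>{- int k..int k}. v a)" by (rule sum.cong) auto
    then have "?u \<in> diagonals (Suc k) f"
      unfolding diagonals_def sum_diagonals_Suc using supp neg sum 1 by auto
    moreover have "v = ?u(?k := Suc (?u ?k))" using 1 by auto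
    ultimately show ?thesis by blast
  next
    case 2
    then have "\<bar>a\<bar> \<le> int k" if "v a \<noteq> 0" for a using small[of a] that by metis
    then have "v \<in> ?B" unfolding diagonals_def using neg sum 2 by auto
    then show ?thesis by blast
  next
    case 3
    let ?u = "v(- ?k := 0)"
    have "(\<Sum>a\<in>{- int k..int k}. ?u a) = (\<Sum>a\<in>{- int k..int k}. v a)" by (rule sum.cong) auto
    moreover have "\<bar>a\<bar> \<le> int k" if "?u a \<noteq> 0" for a using small[of a] that 3 by (metis fun_upd_apply)
    ultimately have "?u \<in> diagonals k f" unfolding diagonals_def using neg sum 3 by auto
    moreover have "v = ?u(- ?k := 1)" using 3 by auto
    ultimately show ?thesis by blast
  qed
next
  let ?k = "int (Suc k)"
  fix v assume "v \<in> ?A \<union> (?B \<union> ?C)"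
  then consider u where "u \<in> diagonals (Suc k) f" "v = u(?k := Suc (u ?k))" | "v \<in> ?B" 
    | u where "u \<in> diagonals k f" "v = u(- ?k := 1)" by blast
  then show "v \<in> ?L"
  proof cases
    case (1 u)
    have "(\<Sum>a\<in>{- int k..int k}. v a) = (\<Sum>a\<in>{- int k..int k}. u a)" unfolding 1 by (rule sum.cong) auto
    then show ?thesis using 1 unfolding diagonals_def sum_diagonals_Suc by auto
  next
    case 2
    then have "v ?k = 0" "v (- ?k) = 0" by (auto intro: diagonals_vanish)
    moreover have "\<bar>a\<bar> \<le> ?k" if "v a \<noteq> 0" for a
      using 2 diagonals_vanish[of v k "Suc f" a] that by (cases "\<bar>a\<bar> > int k") auto
    moreover have "v a \<le> 1" if "a < 0" for a using 2 that unfolding diagonals_def by simp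
    moreover have "(\<Sum>a\<in>{- int k..int k}. v a) = Suc f" using 2 unfolding diagonals_def by simp
    ultimately show ?thesis unfolding diagonals_def sum_diagonals_Suc by simp
  next
    case (3 u)
    have "(\<Sum>a\<in>{- int k..int k}. v a) = (\<Sum>a\<in>{- int k..int k}. u a)" unfolding 3 by (rule sum.cong) auto
    moreover have "u ?k = 0" using 3 by (auto intro: diagonals_vanish)
    moreover have "\<bar>a\<bar> \<le> ?k" if "v a \<noteq> 0" for a
      using 3 diagonals_vanish[of u k f a] that by (cases "\<bar>a\<bar> > int k"; cases "a = - ?k") auto
    moreover have "v a \<le> 1" if "a < 0" for a using 3 that unfolding diagonals_def by simp
    moreover have "(\<Sum>a\<in>{- int k..int k}. u a) = f" using 3 unfolding diagonals_def by simp
    moreover have "v (- ?k) = 1" "v ?k = u ?k" using 3(2) by simp_all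
    ultimately show ?thesis unfolding diagonals_def sum_diagonals_Suc by simp
  qed
qed

text \<open>In generating functions, the label \<open>0\<close> contributes
  \<open>1 / (1 - z)\<close> and each label \<open>a > 0\<close> contributes
  \<open>(1 + z) / (1 - z)\<close>.\<close>

lemma card_diagonals: "finite (diagonals k f) \<and> card (diagonals k f) = delannoy k f"
proof (induction k f rule: delannoy.induct)
  case (3 k f)
  let ?k = "int (Suc k)"
  let ?A = "(\<lambda>v. v(?k := Suc (v ?k))) ` diagonals (Suc k) f" and ?C = "(\<lambda>v. v(- ?k := 1)) ` diagonals k f"
  have injA: "inj_on (\<lambda>v. v(?k := Suc (v ?k))) (diagonals (Suc k) f)"
  proof (rule inj_onI, rule ext)
    fix u v :: "int \<Rightarrow> nat" and a assume eq: "u(?k := Suc (u ?k)) = v(?k := Suc (v ?k))"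
    show "u a = v a" using fun_cong[OF eq, of a] by (auto split: if_splits)
  qed
  have injC: "inj_on (\<lambda>v. v(- ?k := 1)) (diagonals k f)"
  proof (rule inj_onI, rule ext)
    fix u v a assume uv: "u \<in> diagonals k f" "v \<in> diagonals k f" and eq: "u(- ?k := 1) = v(- ?k := 1)"
    show "u a = v a"
      using fun_cong[OF eq, of a] diagonals_vanish[OF uv(1), of a] diagonals_vanish[OF uv(2), of a] by (auto split: if_splits)
  qed
  have A: "v ?k \<noteq> 0" if "v \<in> ?A" for v using that by auto
  have B: "v ?k = 0 \<and> v (- ?k) = 0" if "v \<in> diagonals k (Suc f)" for v using that by (auto intro: diagonals_vanish)
  have C: "v ?k = 0 \<and> v (- ?k) \<noteq> 0" if vC: "v \<in> ?C" for v
  proof -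
    obtain u where u: "u \<in> diagonals k f" "v = u(- ?k := 1)" using vC by blast
    then have "u ?k = 0" by (auto intro: diagonals_vanish)
    then show ?thesis unfolding u by simp
  qed
  have "?A \<inter> (diagonals k (Suc f) \<union> ?C) = {}" using A B C by blast
  moreover have "diagonals k (Suc f) \<inter> ?C = {}" using B C by blast
  ultimately show ?case unfolding diagonals_Suc using 3 injA injC by (simp add: card_Un_disjoint card_image)
qed (simp_all add: diagonals_0 diagonals_origin)

text \<open>The origin receives \<open>2 * v 0\<close> because a fixed point labelled
  \<open>0\<close> shares its cell with its negative. For \<open>a > 0\<close> the negatives lie in
  the opposite cell, which receives its own copy; hence the absolute values.\<close>

definition add_diagonals :: "(int \<Rightarrow> nat) \<Rightarrow> (int \<Rightarrow> int \<Rightarrow> nat) \<Rightarrow> int \<Rightarrow> int \<Rightarrow> nat" where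
  "add_diagonals v M a b = M a b + (if a = 0 \<and> b = 0 then 2 * v 0 else if a = b then v \<bar>a\<bar> else if a = - b then v (- \<bar>a\<bar>) else 0)"

lemma table_fix_eq_0D:
  assumes "table_fix k M = 0" "a \<in> {1..int k}"
  shows "M a a = 0" "even (M a (- a))"
proof -
  have "(\<Sum>a\<in>{1..int k}. M a a + M a (- a) mod 2) = 0"
    using assms(1) unfolding table_fix_def by auto
  then have "\<forall>a\<in>{1..int k}. M a a + M a (- a) mod 2 = 0" by (subst (asm) sum_eq_0_iff) auto
  with assms(2) show "M a a = 0" "even (M a (- a))" by auto
qed

lemma table_size_add_diagonals: "table_size k (add_diagonals v M) = table_size k M + 2 * (\<Sum>a\<in>{- int k..int k}. v a)"
proof -
  let ?K = "{- int k..int k}"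
  let ?E = "\<lambda>a b. (if a = 0 \<and> b = 0 then 2 * v 0 else if a = b then v \<bar>a\<bar> else if a = - b then v (- \<bar>a\<bar>) else 0)"
  have row: "(\<Sum>b\<in>?K. ?E a b) = v \<bar>a\<bar> + v (- \<bar>a\<bar>)" if "a \<in> ?K" for a
  proof -
    have "?E a b = (if b = a then v \<bar>a\<bar> else 0) + (if b = - a then v (- \<bar>a\<bar>) else 0)" for b by auto
    then show ?thesis using that by (simp add: sum.distrib)
  qed
  have "(\<Sum>a\<in>?K. \<Sum>b\<in>?K. ?E a b) = (\<Sum>a\<in>?K. v \<bar>a\<bar> + v (- \<bar>a\<bar>))"
    by (rule sum.cong[OF refl row])
  also have "\<dots> = 2 * (\<Sum>a\<in>?K. v a)"
    unfolding sum_symmetric_interval by (simp add: sum_distrib_left[symmetric] sum.distrib)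
  finally show ?thesis unfolding table_size_def add_diagonals_def by (simp add: sum.distrib)
qed

lemma bij_betw_add_diagonals:
  "bij_betw (\<lambda>(v, M). add_diagonals v M) (diagonals k f \<times> fix_tables n 0 k) (fix_tables (n + f) f k)"
proof -
  \<comment> \<open>\<open>dv\<close> and \<open>rest\<close> form the inverse map:
    \<open>rest\<close> keeps only the dummy position at the origin, empties the main diagonal and
    rounds the antidiagonal down to even numbers.\<close>
  define dv where "dv M a = (if a = 0 then M 0 0 div 2 else if a > 0 then M a a else M a (- a) mod 2)" for M :: "int \<Rightarrow> int \<Rightarrow> nat" and a
  define rest where "rest M a b = (if a = 0 \<and> b = 0 then 1 else if a = b then 0 else if a = - b then 2 * (M a b div 2) else M a b)"
    for M :: "int \<Rightarrow> int \<Rightarrow> nat" and a b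
  have tabD: "M a b \<noteq> 0 \<Longrightarrow> \<bar>a\<bar> \<le> int k \<and> \<bar>b\<bar> \<le> int k" "M a b = M b a" "M (- a) (- b) = M a b" "odd (M 0 0)"
    if "M \<in> tables k" for M a b
    using that unfolding tables_def by blast+
  have neg_diag: "M (- a) a = M a (- a)" "M (- a) (- a) = M a a" if "M \<in> tables k" for M a
    using tabD(2,3)[OF that] by metis+
  have sum_dv: "(\<Sum>a\<in>{- int k..int k}. dv M a) = table_fix k M" if "M \<in> tables k" for M
  proof -
    have "(\<Sum>a\<in>{1..int k}. dv M a + dv M (- a)) = (\<Sum>a\<in>{1..int k}. M a a + M a (- a) mod 2)"
      by (rule sum.cong) (auto simp: dv_def neg_diag[OF that])
    then show ?thesis unfolding sum_symmetric_interval table_fix_def by (simp add: dv_def)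
  qed
  have fixD: "M 0 0 = 1" "a \<noteq> 0 \<Longrightarrow> M a a = 0" "even (M a (- a)) \<or> a = 0" if "M \<in> fix_tables n 0 k" for M a
  proof -
    have M: "M \<in> tables k" "table_fix k M = 0" using that unfolding fix_tables_def by auto
    have "M 0 0 div 2 = 0" using M(2) unfolding table_fix_def by simp
    then show "M 0 0 = 1" using tabD(4)[OF M(1)] by (metis odd_two_times_div_two_succ mult_0_right add_0)
    have pos: "M a a = 0 \<and> even (M a (- a))" if "a > 0" for a
    proof (cases "a \<le> int k")
      case True then show ?thesis using table_fix_eq_0D[OF M(2), of a] that by simp
    next
      case False then show ?thesis using tabD(1)[OF M(1), of a a] tabD(1)[OF M(1), of a "- a"] by force
    qed
    show "M a a = 0" if "a \<noteq> 0" using pos[of a] pos[of "- a"] that neg_diag[OF M(1), of a] by (cases "a > 0") auto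
    show "even (M a (- a)) \<or> a = 0" using pos[of a] pos[of "- a"] neg_diag[OF M(1), of a] by (cases a "0::int" rule: linorder_cases) auto
  qed
  have tab_add: "add_diagonals v M \<in> tables k" if "v \<in> diagonals k f" "M \<in> tables k" for v M
  proof -
    have supp: "v a \<noteq> 0 \<Longrightarrow> \<bar>a\<bar> \<le> int k" for a using that(1) unfolding diagonals_def by blast
    have "add_diagonals v M a b \<noteq> 0 \<Longrightarrow> \<bar>a\<bar> \<le> int k \<and> \<bar>b\<bar> \<le> int k" for a b
      using tabD(1)[OF that(2), of a b] supp[of "\<bar>a\<bar>"] supp[of "- \<bar>a\<bar>"] unfolding add_diagonals_def
      by (cases "M a b = 0") (auto split: if_splits)
    moreover have "add_diagonals v M a b = add_diagonals v M b a" for a b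
      using tabD(2)[OF that(2), of a b] unfolding add_diagonals_def by auto
    moreover have "add_diagonals v M (- a) (- b) = add_diagonals v M a b" for a b
      using tabD(3)[OF that(2), of a b] unfolding add_diagonals_def by auto
    moreover have "odd (add_diagonals v M 0 0)" using tabD(4)[OF that(2)] unfolding add_diagonals_def by simp
    ultimately show ?thesis unfolding tables_def by blast
  qed
  have dv_add: "dv (add_diagonals v M) = v" if "v \<in> diagonals k f" "M \<in> fix_tables n 0 k" for v M
  proof
    fix a
    \<comment> \<open>This bound lets \<open>v a\<close> be recovered as a parity after it was added
      to an even antidiagonal entry.\<close>
    have "v a \<le> 1" if "a < 0" using \<open>v \<in> diagonals k f\<close> that unfolding diagonals_def by blast
    then show "dv (add_diagonals v M) a = v a"
      using fixD(1)[OF that(2)] fixD(2,3)[OF that(2), of a] unfolding dv_def add_diagonals_def 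
      by (cases a "0::int" rule: linorder_cases) (auto elim!: evenE)
  qed
  have rest_add: "rest (add_diagonals v M) = M" if "v \<in> diagonals k f" "M \<in> fix_tables n 0 k" for v M
  proof (intro ext)
    fix a b
    have "v (- \<bar>a\<bar>) \<le> 1" if "a \<noteq> 0" using \<open>v \<in> diagonals k f\<close> that unfolding diagonals_def by auto
    then show "rest (add_diagonals v M) a b = M a b"
      using fixD(1)[OF that(2)] fixD(2,3)[OF that(2), of a] unfolding rest_def add_diagonals_def by (auto elim!: evenE)
  qed
  have add_dv: "add_diagonals (dv M) (rest M) = M" if "M \<in> tables k" for M
  proof (intro ext)
    fix a b
    have "M \<bar>a\<bar> \<bar>a\<bar> = M a a" "M (- \<bar>a\<bar>) \<bar>a\<bar> = M a (- a)" using neg_diag[OF that, of a] by (auto simp: abs_if)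
    then show "add_diagonals (dv M) (rest M) a b = M a b"
      using tabD(4)[OF that] unfolding add_diagonals_def dv_def rest_def by auto
  qed
  have dv_mem: "dv M \<in> diagonals k f" if "M \<in> fix_tables (n + f) f k" for M
  proof -
    have M: "M \<in> tables k" "table_fix k M = f" using that unfolding fix_tables_def by auto
    have "\<bar>a\<bar> \<le> int k" if "dv M a \<noteq> 0" for a
      using that tabD(1)[OF M(1), of a a] tabD(1)[OF M(1), of a "- a"] unfolding dv_def by (force split: if_splits)
    moreover have "dv M a \<le> 1" if "a < 0" for a using that unfolding dv_def by simp
    ultimately show ?thesis unfolding diagonals_def using sum_dv[OF M(1)] M(2) by simp
  qed
  have rest_mem: "rest M \<in> fix_tables n 0 k" if "M \<in> fix_tables (n + f) f k" for M
  proof -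
    have M: "M \<in> tables k" "table_size k M = 2 * (n + f) + 1" "table_fix k M = f" using that unfolding fix_tables_def by auto
    have "rest M \<in> tables k"
    proof -
      have "rest M a b \<noteq> 0 \<Longrightarrow> \<bar>a\<bar> \<le> int k \<and> \<bar>b\<bar> \<le> int k" for a b
        using tabD(1)[OF M(1), of a b] unfolding rest_def by (force split: if_splits)
      moreover have "rest M a b = rest M b a" for a b
        using tabD(2)[OF M(1), of a b] unfolding rest_def by auto
      moreover have "rest M (- a) (- b) = rest M a b" for a b
        using tabD(3)[OF M(1), of a b] unfolding rest_def by auto
      moreover have "odd (rest M 0 0)" unfolding rest_def by simp
      ultimately show ?thesis unfolding tables_def by blast
    qed
    moreover have "table_fix k (rest M) = 0" unfolding table_fix_def rest_def by simp
    moreover have "table_size k (rest M) = 2 * n + 1"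
      using table_size_add_diagonals[of k "dv M" "rest M"] unfolding add_dv[OF M(1)] sum_dv[OF M(1)] M by simp
    ultimately show ?thesis unfolding fix_tables_def by simp
  qed
  have add_mem: "add_diagonals v M \<in> fix_tables (n + f) f k" if "v \<in> diagonals k f" "M \<in> fix_tables n 0 k" for v M
  proof -
    have M: "M \<in> tables k" "table_size k M = 2 * n + 1" using that(2) unfolding fix_tables_def by auto
    have "(\<Sum>a\<in>{- int k..int k}. v a) = f" using that(1) unfolding diagonals_def by simp
    moreover have "table_fix k (add_diagonals v M) = (\<Sum>a\<in>{- int k..int k}. v a)"
      using sum_dv[OF tab_add[OF that(1) M(1)]] unfolding dv_add[OF that] by simp
    ultimately show ?thesis
      using tab_add[OF that(1) M(1)] M unfolding fix_tables_def by (simp add: table_size_add_diagonals)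
  qed
  show ?thesis
    by (rule bij_betw_byWitness[of _ "\<lambda>M. (dv M, rest M)"])
      (auto simp: dv_add rest_add dv_mem rest_mem add_mem intro!: add_dv, simp add: fix_tables_def)
qed

lemma card_fix_tables: "card (fix_tables (n + f) f k) = delannoy k f * card (fix_tables n 0 k)"
  using bij_betw_same_card[OF bij_betw_add_diagonals[of k f n]] by (simp add: card_cartesian_product card_diagonals)

section \<open>Palindromicity\<close>

lemma bij_betw_negate: "bij_betw (map uminus) {w \<in> involutionsB n. fixB w = f} {w \<in> involutionsB n. fixB w = f}"
proof -
  have act: "act (map uminus w) i = - act w i" if "\<bar>i\<bar> \<le> int (length w)" for w i
  proof (cases "i = 0")
    case False
    then have "nat \<bar>i\<bar> - 1 < length w" using that by auto
    then show ?thesis using False by (simp add: act_def)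
  qed simp
  have "map uminus w \<in> {w \<in> involutionsB n. fixB w = f}" if "w \<in> {w \<in> involutionsB n. fixB w = f}" for w
  proof -
    have len: "length w = n" and odd: "odd_involution n (act w)" and fixw: "fixB w = f" using that involutionsB_iff by auto
    have a: "act (map uminus w) i = - act w i" if "i \<in> {- int n..int n}" for i
      using act[of i w] that len by auto
    have "odd_involution n (act (map uminus w))"
      unfolding odd_involution_def
    proof (intro ballI conjI)
      fix i assume i: "i \<in> {- int n..int n}"
      have *: "act w i \<in> {- int n..int n}" "act w (act w i) = i" using odd i unfolding odd_involution_def by auto
      then have "- act w i \<in> {- int n..int n}" by auto
      then show "act (map uminus w) i \<in> {- int n..int n}" "act (map uminus w) (act (map uminus w) i) = i"
        using a i * by (simp_all add: act_minus)
    qed (rule act_minus)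
    moreover have "fixB (map uminus w) = f"
    proof -
      have "{i \<in> {1..int n}. \<bar>act (map uminus w) i\<bar> = i} = {i \<in> {1..int n}. \<bar>act w i\<bar> = i}" using a by auto
      then show ?thesis using fixw unfolding fixB_def by (simp add: len)
    qed
    ultimately show ?thesis using len involutionsB_iff by simp
  qed
  then show ?thesis
    by (intro bij_betw_byWitness[of _ "map uminus"]) (auto simp: comp_def)
qed

text \<open>Neighbouring values differ, also at the start where \<open>act w 0 = 0\<close>, so each
  of the \<open>n\<close> positions is a descent of exactly one of \<open>w\<close> and its
  negative.\<close>

lemma desB_negate:
  assumes "w \<in> involutionsB n"
  shows "desB (map uminus w) + desB w = n"
proof -
  have len: "length w = n" and odd: "odd_involution n (act w)" using assms involutionsB_iff by auto
  have a: "act (map uminus w) i = - act w i" if "i \<in> {0..int n}" for i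
  proof (cases "i = 0")
    case False
    then have "nat \<bar>i\<bar> - 1 < length w" using that len by auto
    then show ?thesis using False by (simp add: act_def)
  qed simp
  have ne: "act w i \<noteq> act w (i + 1)" if "i \<in> {0..<int n}" for i
  proof
    assume "act w i = act w (i + 1)"
    moreover have "act w (act w i) = i" "act w (act w (i + 1)) = i + 1" using odd that unfolding odd_involution_def by auto
    ultimately show False by simp
  qed
  let ?D = "{i \<in> {0..<int n}. act w i > act w (i + 1)}" and ?E = "{i \<in> {0..<int n}. act w i < act w (i + 1)}"
  have "{i \<in> {0..<int n}. act (map uminus w) i > act (map uminus w) (i + 1)} = ?E" using a by auto
  then have "desB (map uminus w) = card ?E" unfolding desB_def by (simp add: len)
  moreover have "desB w = card ?D" unfolding desB_def by (simp add: len)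
  moreover have "{0..<int n} = ?E \<union> ?D" using ne by force
  then have "card {0..<int n} = card (?E \<union> ?D)" by (rule arg_cong)
  moreover have "card (?E \<union> ?D) = card ?E + card ?D"
    by (rule card_Un_disjoint) (auto intro: finite_subset[of _ "{0..<int n}"])
  ultimately show ?thesis by simp
qed

lemma degree_J: "degree (J j) \<le> 2 * j"
  unfolding J_def F_eq
proof (rule degree_sum_le)
  fix w assume "w \<in> {w \<in> involutionsB (2 * j + 0). fixB w = 0}"
  then have "desB w \<le> 2 * j" using desB_negate[of w "2 * j"] by simp
  then show "degree (monom (1 :: rat) (desB w)) \<le> 2 * j" using degree_monom_le order_trans by blast
qed (simp add: finite_involutionsB)

lemma J_palindromic:
  assumes "i \<le> 2 * j"
  shows "coeff (J j) i = coeff (J j) (2 * j - i)"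
proof -
  let ?W = "{w \<in> involutionsB (2 * j). fixB w = 0}"
  have J: "coeff (J j) i = (\<Sum>w\<in>?W. if desB w = i then 1 else 0)" for i
    unfolding J_def F_eq by (simp add: coeff_sum)
  have "coeff (J j) i = (\<Sum>w\<in>?W. if desB (map uminus w) = i then 1 else 0)"
    unfolding J by (rule sum.reindex_bij_betw[OF bij_betw_negate, symmetric])
  also have "\<dots> = coeff (J j) (2 * j - i)"
    unfolding J
  proof (intro sum.cong refl if_cong)
    fix w assume "w \<in> ?W"
    then show "desB (map uminus w) = i \<longleftrightarrow> desB w = 2 * j - i" using desB_negate[of w "2 * j"] assms by auto
  qed
  finally show ?thesis .
qed

text \<open>\<open>P j\<close> is a definite description; the palindromic expansion supplies its
  witness, and comparing coefficients identifies the witness with \<open>D j\<close>.\<close>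

lemma J_gamma_expansion: "J j = (\<Sum>s=0..j. smult (D j s) ([:0, 1:] ^ s * [:1, 1:] ^ (2 * j - 2 * s)))"
  and P_eq: "P j = (\<Sum>s=0..j. monom (D j s) s)"
proof -
  obtain c where c: "J j = (\<Sum>s=0..j. smult (c s) ([:0, 1:] ^ s * [:1, 1:] ^ (2 * j - 2 * s)))"
    using palindromic_gamma_expansion[OF degree_J J_palindromic] by blast
  then have P: "P j = (\<Sum>s=0..j. monom (c s) s)" unfolding P_def by (rule gamma_expansion_poly)
  then have "D j s = c s" if "s \<le> j" for s
    unfolding D_def P using that by (simp add: coeff_sum)
  then show "J j = (\<Sum>s=0..j. smult (D j s) ([:0, 1:] ^ s * [:1, 1:] ^ (2 * j - 2 * s)))"
    "P j = (\<Sum>s=0..j. monom (D j s) s)"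
    using c P by simp_all
qed

theorem theorem1p2:
  assumes D_nat: "\<And>j s. s \<le> j \<Longrightarrow> D j s \<in> \<nat>"
  shows "(\<forall>j. Abs_fps (\<lambda>r. A j r) =
            (\<Sum>s=0..j. fps_const [:D j s:] * xs ^ s * (1 + 4 * xs * W) ^ (2 * j - 2 * s)
                         * (1 + 2 * W + 4 * xs * W\<^sup>2) ^ s))
       \<and> (\<forall>j r i. coeff (A j r) i \<in> \<nat>)
       \<and> (\<forall>j f. \<Phi> j f = (\<Sum>r=0..f. of_nat (f choose r) * A j r))"
proof (intro conjI allI)
  note gf = A_gf_expansion[OF P_eq]
  show "Abs_fps (\<lambda>r. A j r) =
            (\<Sum>s=0..j. fps_const [:D j s:] * xs ^ s * (1 + 4 * xs * W) ^ (2 * j - 2 * s)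
                         * (1 + 2 * W + 4 * xs * W\<^sup>2) ^ s)" for j
    unfolding Abs_fps_A by (rule gf)
  show "coeff (A j r) i \<in> \<nat>" for j r i
  proof -
    have "nat_coeffs (A_gf j)"
      unfolding gf
      by (intro nat_coeffs_sum nat_coeffs_mult nat_coeffs_power nat_coeffs_add nat_coeffs_basic nat_coeffs_const)
        (use D_nat in \<open>auto simp: coeff_pCons split: nat.split\<close>)
    then show ?thesis unfolding nat_coeffs_def A_def by blast
  qed
  show "\<Phi> j f = (\<Sum>r=0..f. of_nat (f choose r) * A j r)" for j f
  proof -
    \<comment> \<open>One sequence, \<open>card (fix_tables (2 * j) 0 k)\<close>, serves every
      \<open>f\<close>; it is the \<open>c\<close> of \<open>Abs_fps_delannoy_gf\<close>.\<close>
    have "fps_of_poly (F j f) = (1 - fps_X) ^ (2 * j + f + 1) 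
      * Abs_fps (\<lambda>k. of_nat (delannoy k f) * of_nat (card (fix_tables (2 * j) 0 k)))" for f
      unfolding F_gf card_fix_tables by simp
    from Abs_fps_delannoy_gf[OF this J_gamma_expansion[unfolded J_def]]
    show ?thesis unfolding \<Phi>_def using binomial_sum_is_gamma_poly[OF _ gf] gamma_poly_eqI by blast
  qed
qed

end
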